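(* Let $M=\sum_{k=1}^\infty\sigma_kB^{H_k}$ be a multi-mixed fractional Brownian motion with parameters $\sigma_k,H_k$, $k\in\mathbb{N}$, let $U$ be the multi-mixed fractional Ornstein--Uhlenbeck process with parameter $\lambda>0$ driven by $M$, and let $H_{\inf}=\inf_kH_k$. Let $p>0$ and $T>0$. Then the equidistant $p$-variations of $M$ and $U$ on $[0,T]$ are equal and $$V^p_T(M)=V^p_T(U)=\begin{cases}\infty, & pH_{\inf}<1,\\[4pt] T\left(\displaystyle\sum_{i:\,H_i=H_{\inf}}\sigma_i^2\right)^{p/2}\mu_p, & pH_{\inf}=1,\\[4pt] 0, & pH_{\inf}>1,\end{cases}$$ where $\mu_p=\mathbb{E}|Z|^p$ for a standard Gaussian random variable $Z$, and an empty sum is $0$.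
   Context: A two-sided fractional Brownian motion (fBm) with Hurst index $H\in(0,1)$ is a centered Gaussian process $(B^H_t)_{t\in\mathbb{R}}$ with continuous paths and covariance $\mathbb{E}[B^H_tB^H_s]=\frac12\left(|t|^{2H}+|s|^{2H}-|t-s|^{2H}\right)$. Multi-mixed fractional Brownian motion (mmfBm): let $\sigma_k>0$, $k\in\mathbb{N}$, satisfy $\sum_{k=1}^\infty\sigma_k^2<\infty$, and let $H_k\in(0,1)$, $k\in\mathbb{N}$, be pairwise distinct with $\inf_kH_k>0$ and $\sup_kH_k<1$. With independent two-sided fBm's $B^{H_k}$, put $M_t=\sum_{k=1}^\infty\sigma_kB^{H_k}_t$, $t\in\mathbb{R}$, the series converging in $L^2(\Omega)$ for each $t$; $M$ is taken in its continuous version. Multi-mixed fractional Ornstein--Uhlenbeck process (mmfOU) with parameter $\lambda>0$: the stationary solution of $\mathrm{d}U_t=-\lambda U_t\,\mathrm{d}t+\mathrm{d}M_t$, that is, $U_t=\int_{-\infty}^t\mathrm{e}^{-\lambda(t-s)}\,\mathrm{d}M_s=M_t-\lambda\int_{-\infty}^t\mathrm{e}^{-\lambda(t-s)}M_s\,\mathrm{d}s$. The equidistant $p$-variation of a process $X$ on $[0,T]$ is the limit in probability $V^p_T(X)=\lim_{n\to\infty}\sum_{k=1}^n|X_{t_k}-X_{t_{k-1}}|^p$ with $t_k=\frac{k}{n}T$; the value $\infty$ means that these sums tend to $\infty$ in probability. *)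

theory Defs
  imports "HOL-Probability.Probability"
begin

text \<open>A real random variable whose law is Gaussian; point masses (variance \<open>0\<close>) are included.\<close>

definition gaussian_rv :: "'a measure \<Rightarrow> ('a \<Rightarrow> real) \<Rightarrow> bool" where
  "gaussian_rv P X \<longleftrightarrow> X \<in> borel_measurable P \<and>
     (\<exists>m. (AE \<omega> in P. X \<omega> = m) \<or> (\<exists>s>0. distributed P lborel X (normal_density m s)))"

definition gaussian_process :: "'a measure \<Rightarrow> (real \<Rightarrow> 'a \<Rightarrow> real) \<Rightarrow> bool" where
  "gaussian_process P X \<longleftrightarrow> (\<forall>t. X t \<in> borel_measurable P) \<and>
     (\<forall>F c. finite F \<longrightarrow> gaussian_rv P (\<lambda>\<omega>. \<Sum>t\<in>F. c t * X t \<omega>))"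

definition continuous_paths :: "'a measure \<Rightarrow> (real \<Rightarrow> 'a \<Rightarrow> real) \<Rightarrow> bool" where
  "continuous_paths P X \<longleftrightarrow> (\<forall>\<omega>\<in>space P. continuous_on UNIV (\<lambda>t. X t \<omega>))"

definition fractional_BM :: "'a measure \<Rightarrow> real \<Rightarrow> (real \<Rightarrow> 'a \<Rightarrow> real) \<Rightarrow> bool" where
  "fractional_BM P H B \<longleftrightarrow> gaussian_process P B \<and> continuous_paths P B \<and>
     (\<forall>t. (LINT \<omega>|P. B t \<omega>) = 0) \<and>
     (\<forall>t s. (LINT \<omega>|P. B t \<omega> * B s \<omega>) =
        (\<bar>t\<bar> powr (2 * H) + \<bar>s\<bar> powr (2 * H) - \<bar>t - s\<bar> powr (2 * H)) / 2)"

text \<open>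
  Independence of the processes is independence of the random elements \<open>\<omega> \<mapsto> (B k t \<omega>)\<^sub>t\<close> of the
  product space over all times.  The \<open>L\<^sup>2\<close> distance is taken as a nonnegative integral, which is
  \<open>\<infinity>\<close> (and not \<open>0\<close>) when the difference is not square integrable.  The components are numbered
  from \<open>0\<close>.
\<close>

definition multi_mixed_fBM ::
    "'a measure \<Rightarrow> (nat \<Rightarrow> real) \<Rightarrow> (nat \<Rightarrow> real) \<Rightarrow> (real \<Rightarrow> 'a \<Rightarrow> real) \<Rightarrow> bool" where
  "multi_mixed_fBM P \<sigma> H M \<longleftrightarrow> (\<exists>B :: nat \<Rightarrow> real \<Rightarrow> 'a \<Rightarrow> real.
     (\<forall>k. fractional_BM P (H k) (B k)) \<and>
     prob_space.indep_vars P (\<lambda>_. \<Pi>\<^sub>M t\<in>(UNIV :: real set). (borel :: real measure))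
       (\<lambda>k \<omega>. \<lambda>t\<in>UNIV. B k t \<omega>) UNIV \<and>
     (\<forall>t. M t \<in> borel_measurable P) \<and>
     (\<forall>t. (\<lambda>n. \<integral>\<^sup>+\<omega>. ennreal ((M t \<omega> - (\<Sum>k<n. \<sigma> k * B k t \<omega>))\<^sup>2) \<partial>P) \<longlonglongrightarrow> 0) \<and>
     continuous_paths P M)"

text \<open>
  The stationary solution of the Langevin equation driven by \<open>M\<close>, where the stochastic integral
  is the pathwise one obtained by partial integration.  If \<open>M\<close> is a multi-mixed fractional Brownian
  motion, the Lebesgue integral below converges absolutely for all \<open>t\<close>, almost surely.
\<close>

definition multi_mixed_fOU :: "real \<Rightarrow> (real \<Rightarrow> 'a \<Rightarrow> real) \<Rightarrow> real \<Rightarrow> 'a \<Rightarrow> real" where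
  "multi_mixed_fOU lam M t \<omega> =
     M t \<omega> - lam * (LINT s:{..t}|lborel. exp (- lam * (t - s)) * M s \<omega>)"

definition p_variation_sum ::
    "real \<Rightarrow> real \<Rightarrow> (real \<Rightarrow> 'a \<Rightarrow> real) \<Rightarrow> nat \<Rightarrow> 'a \<Rightarrow> real" where
  "p_variation_sum p T X n \<omega> =
     (\<Sum>k=1..n. \<bar>X (real k / real n * T) \<omega> - X (real (k - 1) / real n * T) \<omega>\<bar> powr p)"

definition tendsto_in_prob :: "'a measure \<Rightarrow> (nat \<Rightarrow> 'a \<Rightarrow> real) \<Rightarrow> ereal \<Rightarrow> bool" where
  "tendsto_in_prob P S v \<longleftrightarrow> (\<forall>n. S n \<in> borel_measurable P) \<and>
     (case v of
        ereal c \<Rightarrow> \<forall>\<epsilon>>0. (\<lambda>n. measure P {\<omega> \<in> space P. \<bar>S n \<omega> - c\<bar> > \<epsilon>}) \<longlonglongrightarrow> 0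
      | PInfty \<Rightarrow> \<forall>K. (\<lambda>n. measure P {\<omega> \<in> space P. S n \<omega> > K}) \<longlonglongrightarrow> 1
      | MInfty \<Rightarrow> \<forall>K. (\<lambda>n. measure P {\<omega> \<in> space P. S n \<omega> < K}) \<longlonglongrightarrow> 1)"

text \<open>\<open>v\<close> is the equidistant \<open>p\<close>-variation of \<open>X\<close> on \<open>[0,T]\<close> (limits in probability are unique).\<close>

definition has_p_variation ::
    "'a measure \<Rightarrow> real \<Rightarrow> real \<Rightarrow> (real \<Rightarrow> 'a \<Rightarrow> real) \<Rightarrow> ereal \<Rightarrow> bool" where
  "has_p_variation P p T X v \<longleftrightarrow> tendsto_in_prob P (p_variation_sum p T X) v"

definition gaussian_abs_moment :: "real \<Rightarrow> real" where
  "gaussian_abs_moment p = (LINT z|std_normal_distribution. \<bar>z\<bar> powr p)"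

end

theory Submission
  imports Defs
begin

text \<open>
  With \<open>h = T / n\<close> and \<open>V h = E (M\<^sub>h)\<^sup>2 = \<Sum>\<^sub>k \<sigma>\<^sub>k\<^sup>2 h\<^bsup>2 H\<^sub>k\<^esup>\<close>, the \<open>p\<close>-variation sum of \<open>M\<close> is
  \<open>n (V h)\<^bsup>p/2\<^esup>\<close> times the mean of \<open>|Y|\<^sup>p\<close> over the \<open>n\<close> standardised increments \<open>Y\<close>.  The
  correlation of two of them is a convex combination of correlations of fractional Gaussian noises,
  so it is bounded by \<open>2 (d - 1)\<^bsup>2 sup H - 2\<^esup>\<close> at lag \<open>d\<close>, uniformly in \<open>n\<close>; the variance of the mean
  then tends to \<open>0\<close> and the mean tends to \<open>\<mu>\<^sub>p > 0\<close> in probability.  Hence the three cases are the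
  limits of the deterministic factor \<open>n (V h)\<^bsup>p/2\<^esup>\<close>.  Finally \<open>M - U\<close> is almost surely Lipschitz on
  \<open>[0, T]\<close>, and its increments, being of order \<open>h = o(\<surd>V h)\<close>, do not change the limit of the mean.
\<close>

section \<open>Independence from characteristic functions\<close>

text \<open>The joint law of the increments cannot be read off the definition, which gives Gaussian
  linear combinations of each component separately and \<open>M\<close> only as an
  \<open>L^2\<close> limit at each time. All joint information is therefore carried by
  characteristic functions of finite linear combinations: they multiply over independent components,
  survive the limit, and turn zero correlation into independence. That last point is needed to show
  that a small correlation of a standard Gaussian pair makes the covariance of the absolute
  \<open>p\<close>-th powers small. Since the indices differ, no power of \<open>h\<close> scales
  \<open>M\<close>, and the correlations change with \<open>n\<close>; a correlation bound uniform
  in \<open>n\<close> takes the place of self-similarity and an ergodic theorem. The infimum of the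
  indices enters the deterministic factor in two ways. If it lies below \<open>1 / p\<close>, some
  component has \<open>p * H k < 1\<close> and alone forces divergence, even when the infimum is not
  attained. Otherwise \<open>V h / h powr (2 * H_inf)\<close> converges to the sum over the minimal
  indices, which is empty, hence \<open>0\<close>, when there are none.\<close>

lemma (in finite_measure) integral_indicator_compose:
  assumes [measurable]: "Z \<in> measurable M N" "A \<in> sets N"
  shows "(LINT x|M. indicator A (Z x) :: real) = measure M (Z -` A \<inter> space M)"
proof -
  have "(LINT x|M. indicator A (Z x) :: real) = (LINT x|M. indicator (Z -` A \<inter> space M) x)"
    by (intro Bochner_Integration.integral_cong) (auto simp: indicator_def)
  then show ?thesis by simp
qed

text \<open>Normalised, \<open>w\<close> is the density of a second probability measure, under which
  \<open>Z\<close> has the same characteristic function as under \<open>M\<close>; Levy uniqueness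
  then identifies the two laws of \<open>Z\<close>. A weight of mean \<open>0\<close> vanishes
  almost everywhere and cannot be normalised, hence the case split. In this form, independence of
  two variables reduces to uniqueness for one real variable.\<close>

lemma (in prob_space) weighted_prob_eq_if_char_eq:
  fixes w Z :: "'a \<Rightarrow> real"
  assumes w: "integrable M w" "\<And>x. 0 \<le> w x" and Z [measurable]: "random_variable borel Z"
    and char_eq: "\<And>t. (CLINT x|M. w x *\<^sub>R iexp (t * Z x)) = expectation w *\<^sub>R (CLINT x|M. iexp (t * Z x))"
    and A [measurable]: "A \<in> sets borel"
  shows "expectation (\<lambda>x. w x * indicator A (Z x)) = expectation w * prob (Z -` A \<inter> space M)"
proof (cases "expectation w = 0")
  case True
  then have "AE x in M. w x = 0"
    using integral_nonneg_eq_0_iff_AE[OF w(1)] w(2) by simp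
  then have "expectation (\<lambda>x. w x * indicator A (Z x)) = expectation (\<lambda>x. 0)"
    using w(1) by (intro integral_cong_AE) auto
  with True show ?thesis by simp
next
  case False
  define c where "c = expectation w"
  have c: "c > 0" using False w(2) by (simp add: c_def integral_nonneg order_less_le)
  have [measurable]: "w \<in> borel_measurable M" using w(1) by simp
  define g where "g x = w x / c" for x
  have g [measurable]: "g \<in> borel_measurable M" and g0: "\<And>x. 0 \<le> g x" and gi: "integrable M g"
    and g1: "expectation g = 1"
    using w c by (auto simp: g_def[abs_def] c_def)
  define N where "N = density M (\<lambda>x. ennreal (g x))"
  have spN: "space N = space M" by (simp add: N_def)
  interpret N: prob_space N
    by (rule prob_spaceI)
      (use g0 g1 gi in \<open>simp add: N_def emeasure_density nn_integral_eq_integral cong: nn_integral_cong_simp\<close>)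
  have ZN [measurable]: "Z \<in> borel_measurable N"
    by (simp add: N_def)
  have "char (distr N borel Z) t = char (distr M borel Z) t" for t
  proof -
    have "char (distr N borel Z) t = (CLINT x|N. iexp (t * Z x))"
      by (simp add: char_def integral_distr)
    also have "\<dots> = (CLINT x|M. g x *\<^sub>R iexp (t * Z x))"
      unfolding N_def by (intro integral_density) (auto simp: g0)
    also have "\<dots> = (1 / c) *\<^sub>R (CLINT x|M. w x *\<^sub>R iexp (t * Z x))"
      unfolding integral_scaleR_right[symmetric] by (simp add: g_def)
    also have "\<dots> = (CLINT x|M. iexp (t * Z x))"
      unfolding char_eq c_def[symmetric] using c by (simp del: of_real_mult)
    finally show ?thesis by (simp add: char_def integral_distr)
  qed
  then have "distr N borel Z = distr M borel Z"
    by (intro Levy_uniqueness N.real_distribution_distr real_distribution_distr) auto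
  then have "measure (distr N borel Z) A = measure (distr M borel Z) A" by simp
  then have "measure N (Z -` A \<inter> space M) = prob (Z -` A \<inter> space M)"
    by (simp add: measure_distr spN)
  also have "measure N (Z -` A \<inter> space M) = integral\<^sup>L N (\<lambda>x. indicator A (Z x))"
    unfolding spN[symmetric] by (rule N.integral_indicator_compose[OF ZN A, symmetric])
  also have "\<dots> = expectation (\<lambda>x. g x *\<^sub>R indicator A (Z x))"
    unfolding N_def by (intro integral_density) (auto simp: g0)
  also have "\<dots> = expectation (\<lambda>x. w x * indicator A (Z x)) / c"
    unfolding integral_divide_zero[symmetric] by (simp add: g_def)
  finally show ?thesis using c by (simp add: c_def[symmetric] field_simps)
qed

text \<open>
  Two uses of Levy uniqueness: weighting by \<open>2 + cos (s X)\<close> and \<open>2 + sin (s X)\<close> does not change the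
  law of \<open>Z\<close>, so weighting by \<open>indicator A Z\<close> does not change the characteristic function of \<open>X\<close>.
\<close>

lemma (in prob_space) indep_var_if_char_mult:
  fixes X Z :: "'a \<Rightarrow> real"
  assumes X [measurable]: "random_variable borel X" and Z [measurable]: "random_variable borel Z"
    and mult: "\<And>s t. (CLINT x|M. iexp (s * X x + t * Z x)) =
      (CLINT x|M. iexp (s * X x)) * (CLINT x|M. iexp (t * Z x))"
  shows "indep_var borel X borel Z"
proof -
  have int: "integrable M (\<lambda>x. iexp (s * X x + t * Z x))" for s t
    by (intro integrable_const_bound[of _ 1]) auto
  have intX: "integrable M (\<lambda>x. iexp (s * X x))" for s
    by (intro integrable_const_bound[of _ 1]) auto
  have intZ: "integrable M (\<lambda>x. iexp (s * Z x))" for s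
    by (intro integrable_const_bound[of _ 1]) auto
  have ic: "integrable M (\<lambda>x. cos (s * X x))" "integrable M (\<lambda>x. sin (s * X x))" for s
    by (intro integrable_const_bound[of _ 1]; simp)+
  have Re_char: "(CLINT x|M. iexp (s * X x)) =
      Complex (expectation (\<lambda>x. cos (s * X x))) (expectation (\<lambda>x. sin (s * X x)))" for s
    using integral_Re[OF intX[of s]] integral_Im[OF intX[of s]]
    by (auto simp: complex_eq_iff Re_exp Im_exp)
  \<comment> \<open>The cosine is the half sum of \<open>iexp (s * X x)\<close> and
    \<open>iexp ((-s) * X x)\<close>, so the product formula at \<open>s\<close> and at
    \<open>-s\<close> gives this one; the sine is the corresponding difference.\<close>
  have cos_mult: "(CLINT x|M. cos (s * X x) *\<^sub>R iexp (t * Z x)) =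
      expectation (\<lambda>x. cos (s * X x)) *\<^sub>R (CLINT x|M. iexp (t * Z x))" for s t
  proof -
    have "cos (s * X x) *\<^sub>R iexp (t * Z x) =
        (iexp (s * X x + t * Z x) + iexp ((-s) * X x + t * Z x)) / 2" for x
      by (simp add: complex_eq_iff Re_exp Im_exp cos_add sin_add cos_diff sin_diff)
    then have "(CLINT x|M. cos (s * X x) *\<^sub>R iexp (t * Z x)) =
      ((CLINT x|M. iexp (s * X x + t * Z x)) + (CLINT x|M. iexp ((-s) * X x + t * Z x))) / 2"
      by (simp only: integral_divide_zero Bochner_Integration.integral_add[OF int int])
    then show ?thesis
      unfolding mult distrib_right[symmetric] Re_char
      by (simp add: complex_eq_iff)
  qed
  have sin_mult: "(CLINT x|M. sin (s * X x) *\<^sub>R iexp (t * Z x)) =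
      expectation (\<lambda>x. sin (s * X x)) *\<^sub>R (CLINT x|M. iexp (t * Z x))" for s t
  proof -
    have "sin (s * X x) *\<^sub>R iexp (t * Z x) =
        (iexp (s * X x + t * Z x) - iexp ((-s) * X x + t * Z x)) / (2 * \<i>)" for x
      by (simp add: complex_eq_iff Re_exp Im_exp cos_add sin_add cos_diff sin_diff)
    then have "(CLINT x|M. sin (s * X x) *\<^sub>R iexp (t * Z x)) =
      ((CLINT x|M. iexp (s * X x + t * Z x)) - (CLINT x|M. iexp ((-s) * X x + t * Z x))) / (2 * \<i>)"
      by (simp only: integral_divide_zero Bochner_Integration.integral_diff[OF int int])
    then show ?thesis
      unfolding mult left_diff_distrib[symmetric] Re_char
      by (simp add: complex_eq_iff)
  qed
  have trig: "expectation (\<lambda>x. f x * indicator A (Z x)) = expectation f * prob (Z -` A \<inter> space M)"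
    if f: "integrable M f" "\<And>x. \<bar>f x\<bar> \<le> 1"
      "\<And>t. (CLINT x|M. f x *\<^sub>R iexp (t * Z x)) = expectation f *\<^sub>R (CLINT x|M. iexp (t * Z x))"
      and A [measurable]: "A \<in> sets borel" for f A
  proof -
    have [measurable]: "f \<in> borel_measurable M" using f(1) by simp
    have i1: "integrable M (\<lambda>x. f x *\<^sub>R iexp (t * Z x))" for t
      using f(2) by (intro integrable_const_bound[of _ 1]) auto
    have i2: "integrable M (\<lambda>x. f x * indicator A (Z x))" "integrable M (\<lambda>x. indicator A (Z x) :: real)"
      using f(2) by (intro integrable_const_bound[of _ 1]; auto simp: indicator_def)+
    have ind: "expectation (\<lambda>x. indicator A (Z x)) = prob (Z -` A \<inter> space M)"
      by (rule integral_indicator_compose[OF Z A])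
    have "expectation (\<lambda>x. (2 + f x) * indicator A (Z x)) = expectation (\<lambda>x. 2 + f x) * prob (Z -` A \<inter> space M)"
    proof (rule weighted_prob_eq_if_char_eq)
      show "0 \<le> 2 + f x" for x using f(2)[of x] by (auto simp: abs_le_iff)
      show "(CLINT x|M. (2 + f x) *\<^sub>R iexp (t * Z x)) =
         expectation (\<lambda>x. 2 + f x) *\<^sub>R (CLINT x|M. iexp (t * Z x))" for t
        using intZ[of t] i1[of t] f(1) f(3)[of t] by (simp add: scaleR_add_left prob_space)
    qed (use f(1) in auto)
    then show ?thesis using i2 f(1) by (simp add: distrib_right ind prob_space)
  qed
  have joint: "prob ((X -` B \<inter> space M) \<inter> (Z -` A \<inter> space M)) = prob (X -` B \<inter> space M) * prob (Z -` A \<inter> space M)"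
    if [measurable]: "A \<in> sets borel" "B \<in> sets borel" for A B
  proof -
    define p where "p = prob (Z -` A \<inter> space M)"
    have ind: "expectation (\<lambda>x. indicator A (Z x)) = p"
      unfolding p_def
      by (rule integral_indicator_compose[OF Z that(1)])
    have "expectation (\<lambda>x. indicator A (Z x) * indicator B (X x)) =
        expectation (\<lambda>x. indicator A (Z x)) * prob (X -` B \<inter> space M)"
    proof (rule weighted_prob_eq_if_char_eq)
      show "integrable M (\<lambda>x. indicator A (Z x) :: real)"
        by (intro integrable_const_bound[of _ 1]) (auto simp: indicator_def)
      fix t
      have i: "integrable M (\<lambda>x. indicator A (Z x) *\<^sub>R iexp (t * X x))"
        by (intro integrable_const_bound[of _ 1]) (auto simp: indicator_def)
      have "expectation (\<lambda>x. indicator A (Z x) * cos (t * X x)) = p * expectation (\<lambda>x. cos (t * X x))"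
        using trig[OF ic(1) _ cos_mult, of t A] by (simp add: mult.commute p_def)
      moreover have "expectation (\<lambda>x. indicator A (Z x) * sin (t * X x)) = p * expectation (\<lambda>x. sin (t * X x))"
        using trig[OF ic(2) _ sin_mult, of t A] by (simp add: mult.commute p_def)
      ultimately show "(CLINT x|M. indicator A (Z x) *\<^sub>R iexp (t * X x)) =
          expectation (\<lambda>x. indicator A (Z x)) *\<^sub>R (CLINT x|M. iexp (t * X x))"
        unfolding Re_char ind using integral_Re[OF i] integral_Im[OF i]
        by (auto simp: complex_eq_iff Re_exp Im_exp)
    qed auto
    also have "expectation (\<lambda>x. indicator A (Z x) * indicator B (X x) :: real) =
        expectation (indicator ((X -` B \<inter> space M) \<inter> (Z -` A \<inter> space M)))"
      by (intro Bochner_Integration.integral_cong) (auto simp: indicator_def)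
    finally show ?thesis by (simp add: ind p_def mult.commute)
  qed
  have "indep_set {X -` A \<inter> space M | A. A \<in> sets borel} {Z -` A \<inter> space M | A. A \<in> sets borel}"
    unfolding indep_sets2_eq using joint by auto
  then have "indep_set (sigma_sets (space M) {X -` A \<inter> space M | A. A \<in> sets borel})
      (sigma_sets (space M) {Z -` A \<inter> space M | A. A \<in> sets borel})"
    by (rule indep_set_sigma_sets) (auto simp: Int_stable_def; metis sets.Int vimage_Int Int_assoc Int_commute Int_left_commute Int_absorb)+
  then show ?thesis unfolding indep_var_eq by simp
qed

section \<open>Absolute moments of Gaussian pairs\<close>

text \<open>If \<open>e\<close> is small relative to \<open>y\<close>, continuity of
  \<open>\<bar>1 + u\<bar> powr p\<close> at \<open>u = 0\<close> gives the relative error \<eta>,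
  after scaling by \<open>\<bar>y\<bar> powr p\<close>. Otherwise both \<open>y\<close> and
  \<open>y + e\<close> are bounded by a multiple of \<open>e\<close>. This replaces the triangle
  inequality for \<open>p\<close>-th powers and treats \<open>p < 1\<close> and
  \<open>p \<ge> 1\<close> alike.\<close>

lemma abs_powr_add_diff_le:
  fixes p \<eta> :: real
  assumes "p > 0" "\<eta> > 0"
  obtains C where "C > 0"
    "\<And>y e. \<bar>\<bar>y + e\<bar> powr p - \<bar>y\<bar> powr p\<bar> \<le> \<eta> * \<bar>y\<bar> powr p + C * \<bar>e\<bar> powr p"
proof -
  have "isCont (\<lambda>u. \<bar>1 + u\<bar> powr p) 0"
    by (intro continuous_intros) auto
  then obtain \<delta> where \<delta>: "\<delta> > 0" "\<And>u. \<bar>u\<bar> < \<delta> \<Longrightarrow> \<bar>\<bar>1 + u\<bar> powr p - 1\<bar> < \<eta>"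
    unfolding continuous_at_eps_delta using \<open>\<eta> > 0\<close> by (auto simp: dist_real_def)
  define C where "C = (1 + 1 / \<delta>) powr p"
  have "\<bar>\<bar>y + e\<bar> powr p - \<bar>y\<bar> powr p\<bar> \<le> \<eta> * \<bar>y\<bar> powr p + C * \<bar>e\<bar> powr p" for y e
  proof (cases "\<bar>e\<bar> < \<delta> * \<bar>y\<bar>")
    case True
    then have y: "y \<noteq> 0" by auto
    have "y + e = y * (1 + e / y)" using y by (simp add: field_simps)
    then have "\<bar>y + e\<bar> powr p = \<bar>y\<bar> powr p * \<bar>1 + e / y\<bar> powr p"
      by (simp only: abs_mult powr_mult abs_ge_zero)
    then have "\<bar>\<bar>y + e\<bar> powr p - \<bar>y\<bar> powr p\<bar> = \<bar>y\<bar> powr p * \<bar>\<bar>1 + e / y\<bar> powr p - 1\<bar>"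
      using abs_mult[of "\<bar>y\<bar> powr p" "\<bar>1 + e / y\<bar> powr p - 1"] by (simp add: right_diff_distrib)
    also have "\<dots> \<le> \<bar>y\<bar> powr p * \<eta>"
      using \<delta>(2)[of "e / y"] True y by (intro mult_left_mono) (auto simp: field_simps abs_divide)
    also have "\<dots> \<le> \<eta> * \<bar>y\<bar> powr p + C * \<bar>e\<bar> powr p"
      using \<delta> by (simp add: C_def)
    finally show ?thesis .
  next
    case False
    then have 1: "\<bar>y\<bar> \<le> \<bar>e\<bar> / \<delta>" using \<delta> by (simp add: field_simps)
    have *: "\<bar>z\<bar> powr p \<le> C * \<bar>e\<bar> powr p" if "\<bar>z\<bar> \<le> (1 + 1 / \<delta>) * \<bar>e\<bar>" for z
    proof -
      have "\<bar>z\<bar> powr p \<le> ((1 + 1 / \<delta>) * \<bar>e\<bar>) powr p"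
        using that \<open>p > 0\<close> by (intro powr_mono2) auto
      then show ?thesis using \<delta> by (simp add: C_def powr_mult)
    qed
    have "\<bar>y + e\<bar> powr p \<le> C * \<bar>e\<bar> powr p" "\<bar>y\<bar> powr p \<le> C * \<bar>e\<bar> powr p"
      using 1 by (intro *; simp add: algebra_simps)+
    then have "\<bar>\<bar>y + e\<bar> powr p - \<bar>y\<bar> powr p\<bar> \<le> C * \<bar>e\<bar> powr p"
      using powr_ge_zero[of "\<bar>y + e\<bar>" p] powr_ge_zero[of "\<bar>y\<bar>" p] by argo
    then show ?thesis using \<open>\<eta> > 0\<close> by (simp add: add_increasing)
  qed
  moreover have "C > 0" using \<delta>(1) add_pos_pos[of 1 "1 / \<delta>"] by (simp add: C_def)
  ultimately show thesis by (rule that[rotated])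
qed

lemma integrable_std_normal_abs_powr:
  assumes "q \<ge> 0"
  shows "integrable std_normal_distribution (\<lambda>z. \<bar>z\<bar> powr q)"
proof (rule Bochner_Integration.integrable_bound)
  interpret N: real_distribution std_normal_distribution by (rule real_dist_normal_dist)
  \<comment> \<open>The even exponent \<open>2 * m\<close> is at least \<open>q\<close>, and even
    powers give a nonnegative polynomial bound with finite Gaussian moments.\<close>
  define m where "m = nat \<lceil>q\<rceil>"
  show "integrable std_normal_distribution (\<lambda>z. 1 + z ^ (2 * m))"
    by (intro Bochner_Integration.integrable_add integrable_std_normal_distribution_moment) simp
  have "\<bar>z\<bar> powr q \<le> 1 + z ^ (2 * m)" for z :: real
  proof (cases "\<bar>z\<bar> \<le> 1")
    case True
    then have "\<bar>z\<bar> powr q \<le> 1" using assms by (simp add: powr_le1)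
    then show ?thesis by (simp add: add_increasing2)
  next
    case False
    have "\<bar>z\<bar> powr q \<le> \<bar>z\<bar> powr real (2 * m)"
      using False assms by (intro powr_mono) (auto simp: m_def, linarith)
    also have "\<dots> = z ^ (2 * m)"
      using False by (subst powr_realpow) (auto simp: power_even_abs)
    finally show ?thesis by simp
  qed
  then show "AE z in std_normal_distribution. norm (\<bar>z\<bar> powr q) \<le> norm (1 + z ^ (2 * m))"
    by (intro AE_I2) (simp add: add_nonneg_nonneg)
qed simp

text \<open>The normal density is positive, so a vanishing moment would force \<open>z = 0\<close>
  Lebesgue-almost everywhere. The strict sign is what turns a diverging scale factor into a
  diverging \<open>p\<close>-variation.\<close>

lemma gaussian_abs_moment_pos: 
  assumes "p > 0"
  shows "gaussian_abs_moment p > 0"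
proof -
  interpret N: real_distribution std_normal_distribution by (rule real_dist_normal_dist)
  have int: "integrable std_normal_distribution (\<lambda>z. \<bar>z\<bar> powr p)"
    using assms by (intro integrable_std_normal_abs_powr) auto
  have "gaussian_abs_moment p \<noteq> 0"
  proof
    assume "gaussian_abs_moment p = 0"
    then have "AE z in std_normal_distribution. \<bar>z\<bar> powr p = 0"
      unfolding gaussian_abs_moment_def using integral_nonneg_eq_0_iff_AE[OF int] by simp
    then have "AE z in lborel. z = (0::real)"
      by (simp add: AE_density normal_density_pos)
    then have "AE z in lborel. (z::real) \<noteq> z"
      using AE_lborel_singleton[of "0::real"] by eventually_elim simp
    then show False by (simp add: eventually_False ae_filter_eq_bot_iff)
  qed
  then show ?thesis unfolding gaussian_abs_moment_def
    by (simp add: order_less_le)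
qed

text \<open>The characteristic function of a centred bivariate normal law with unit variances and
  correlation \<open>r\<close>. Unlike a joint density, it makes sense for
  \<open>\<bar>r\<bar> = 1\<close> too; this covers a variable paired with itself.\<close>

definition std_gaussian_pair :: "'a measure \<Rightarrow> real \<Rightarrow> ('a \<Rightarrow> real) \<Rightarrow> ('a \<Rightarrow> real) \<Rightarrow> bool" where
  "std_gaussian_pair M r X Y \<longleftrightarrow> X \<in> borel_measurable M \<and> Y \<in> borel_measurable M \<and>
     (\<forall>a b. (CLINT x|M. iexp (a * X x + b * Y x)) =
        complex_of_real (exp (- (a\<^sup>2 + 2 * r * a * b + b\<^sup>2) / 2)))"

lemma std_gaussian_pair_sym: "std_gaussian_pair M r X Y \<Longrightarrow> std_gaussian_pair M r Y X"
  unfolding std_gaussian_pair_def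
proof (elim conjE, intro conjI allI)
  fix a b
  assume *: "\<forall>a b. (CLINT x|M. iexp (a * X x + b * Y x)) =
    complex_of_real (exp (- (a\<^sup>2 + 2 * r * a * b + b\<^sup>2) / 2))"
  have "a * Y x + b * X x = b * X x + a * Y x" for x by simp
  moreover have "a\<^sup>2 + 2 * r * a * b + b\<^sup>2 = b\<^sup>2 + 2 * r * b * a + a\<^sup>2" by simp
  ultimately show "(CLINT x|M. iexp (a * Y x + b * X x)) =
      complex_of_real (exp (- (a\<^sup>2 + 2 * r * a * b + b\<^sup>2) / 2))"
    using spec[OF spec[OF *, of b], of a] by (simp only:)
qed

section \<open>Covariance of absolute powers of a standard Gaussian pair\<close>

context prob_space
begin

lemma std_gaussian_pair_distr:
  assumes "std_gaussian_pair M r X Y"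
  shows "distr M borel X = std_normal_distribution"
proof -
  have [measurable]: "random_variable borel X" using assms by (simp add: std_gaussian_pair_def)
  show ?thesis
  proof (rule Levy_uniqueness)
    show "char (distr M borel X) = char std_normal_distribution"
    proof
      fix t
      have "(CLINT x|M. iexp (t * X x + 0 * Y x)) = complex_of_real (exp (- (t\<^sup>2 + 2 * r * t * 0 + 0\<^sup>2) / 2))"
        using assms unfolding std_gaussian_pair_def by blast
      then show "char (distr M borel X) t = char std_normal_distribution t"
        by (simp add: char_std_normal_distribution char_def integral_distr)
    qed
  qed (auto simp: real_dist_normal_dist)
qed

lemma
  assumes "std_gaussian_pair M r X Y" and "q \<ge> 0"
  shows std_gaussian_pair_integrable: "integrable M (\<lambda>x. \<bar>X x\<bar> powr q)"
    and std_gaussian_pair_expectation: "expectation (\<lambda>x. \<bar>X x\<bar> powr q) = gaussian_abs_moment q"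
proof -
  have [measurable]: "random_variable borel X" using assms by (simp add: std_gaussian_pair_def)
  have "integrable (distr M borel X) (\<lambda>z. \<bar>z\<bar> powr q)"
    using integrable_std_normal_abs_powr[OF assms(2)] by (simp add: std_gaussian_pair_distr[OF assms(1)])
  then show "integrable M (\<lambda>x. \<bar>X x\<bar> powr q)"
    by (subst (asm) integrable_distr_eq) auto
  have "expectation (\<lambda>x. \<bar>X x\<bar> powr q) = (LINT z|distr M borel X. \<bar>z\<bar> powr q)"
    by (subst integral_distr) auto
  then show "expectation (\<lambda>x. \<bar>X x\<bar> powr q) = gaussian_abs_moment q"
    by (simp add: std_gaussian_pair_distr[OF assms(1)] gaussian_abs_moment_def)
qed

text \<open>From \<open>2 * u * v \<le> u\<^sup>2 + v\<^sup>2\<close>. The bound is independent of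
  \<open>r\<close>, so it serves for the pairs of increments that are too close in time to be nearly
  uncorrelated.\<close>

lemma std_gaussian_pair_abs_powr_mult:
  assumes G: "std_gaussian_pair M r X Y" and "p > 0"
  shows std_gaussian_pair_integrable_mult: "integrable M (\<lambda>x. \<bar>X x\<bar> powr p * \<bar>Y x\<bar> powr p)"
    and "expectation (\<lambda>x. \<bar>X x\<bar> powr p * \<bar>Y x\<bar> powr p) \<le> gaussian_abs_moment (2 * p)"
proof -
  have [measurable]: "random_variable borel X" "random_variable borel Y"
    using assms by (auto simp: std_gaussian_pair_def)
  note G' = std_gaussian_pair_sym[OF G]
  have i: "integrable M (\<lambda>x. \<bar>X x\<bar> powr (2*p))" "integrable M (\<lambda>x. \<bar>Y x\<bar> powr (2*p))"
    using std_gaussian_pair_integrable[OF G] std_gaussian_pair_integrable[OF G'] \<open>p > 0\<close> by simp_all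
  have le: "\<bar>x\<bar> powr p * \<bar>y\<bar> powr p \<le> (\<bar>x\<bar> powr (2*p) + \<bar>y\<bar> powr (2*p)) / 2" for x y :: real
  proof -
    have "0 \<le> (\<bar>x\<bar> powr p - \<bar>y\<bar> powr p)\<^sup>2" by simp
    moreover have "\<bar>z\<bar> powr (2*p) = (\<bar>z\<bar> powr p)\<^sup>2" for z :: real
      by (simp add: power2_eq_square powr_add[symmetric])
    ultimately show ?thesis by (simp add: power2_diff)
  qed
  show int: "integrable M (\<lambda>x. \<bar>X x\<bar> powr p * \<bar>Y x\<bar> powr p)"
    by (rule Bochner_Integration.integrable_bound[of M "\<lambda>x. (\<bar>X x\<bar> powr (2*p) + \<bar>Y x\<bar> powr (2*p)) / 2"])
       (use i le in auto)
  have "expectation (\<lambda>x. \<bar>X x\<bar> powr p * \<bar>Y x\<bar> powr p) \<le>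
      expectation (\<lambda>x. (\<bar>X x\<bar> powr (2*p) + \<bar>Y x\<bar> powr (2*p)) / 2)"
    by (intro integral_mono int) (use i le in auto)
  also have "\<dots> = gaussian_abs_moment (2 * p)"
    using i std_gaussian_pair_expectation[OF G, of "2*p"] std_gaussian_pair_expectation[OF G', of "2*p"] \<open>p > 0\<close>
    by simp
  finally show "expectation (\<lambda>x. \<bar>X x\<bar> powr p * \<bar>Y x\<bar> powr p) \<le> gaussian_abs_moment (2 * p)" .
qed

text \<open>Without the mixed term the exponent splits, and the joint characteristic function is a
  product.\<close>

lemma std_gaussian_pair_indep_var:
  assumes "std_gaussian_pair M 0 X Z"
  shows "indep_var borel X borel Z"
proof (rule indep_var_if_char_mult)
  fix s t
  have *: "(CLINT x|M. iexp (a * X x + b * Z x)) = complex_of_real (exp (- (a\<^sup>2 + 2 * 0 * a * b + b\<^sup>2) / 2))" for a b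
    using assms unfolding std_gaussian_pair_def by blast
  show "(CLINT x|M. iexp (s * X x + t * Z x)) = (CLINT x|M. iexp (s * X x)) * (CLINT x|M. iexp (t * Z x))"
    using *[of s t] *[of s 0] *[of 0 t]
    by (simp add: exp_add[symmetric] add_divide_distrib flip: of_real_mult of_real_add)
qed (use assms in \<open>auto simp: std_gaussian_pair_def\<close>)

text \<open>Continuity at \<open>r = 0\<close> is enough; no rate in \<open>r\<close> is asserted.
  The essential point is that \<delta> depends only on \<open>p\<close> and \<epsilon> and not on
  the pair, so that it can be used uniformly over a triangular array.\<close>

lemma std_gaussian_pair_abs_powr_cov:
  assumes p: "p > 0" and "\<epsilon> > 0"
  obtains \<delta> where "\<delta> > 0" "\<And>r X Y. std_gaussian_pair M r X Y \<Longrightarrow> \<bar>r\<bar> < \<delta> \<Longrightarrow>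
    \<bar>expectation (\<lambda>x. \<bar>X x\<bar> powr p * \<bar>Y x\<bar> powr p) - (gaussian_abs_moment p)\<^sup>2\<bar> < \<epsilon>"
proof -
  define \<mu> where "\<mu> = gaussian_abs_moment p"
  define \<nu> where "\<nu> = gaussian_abs_moment (2 * p)"
  have \<mu>: "\<mu> > 0" using p by (simp add: \<mu>_def gaussian_abs_moment_pos)
  \<comment> \<open>Chosen so that \<open>g 0 = \<eta> * \<mu>\<^sup>2\<close> equals
    \<open>\<epsilon> / 2\<close>; the other two terms of \<open>g\<close> vanish at
    \<open>0\<close>.\<close>
  define \<eta> where "\<eta> = \<epsilon> / (2 * \<mu>\<^sup>2)"
  have \<eta>: "\<eta> > 0" using \<mu> \<open>\<epsilon> > 0\<close> by (simp add: \<eta>_def)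
  obtain C where C: "C > 0"
    "\<And>y e. \<bar>\<bar>y + e\<bar> powr p - \<bar>y\<bar> powr p\<bar> \<le> \<eta> * \<bar>y\<bar> powr p + C * \<bar>e\<bar> powr p"
    using abs_powr_add_diff_le[OF p \<eta>] by blast
  define s where "s r = sqrt (1 - r\<^sup>2)" for r :: real
  define g where "g r = \<bar>s r powr p - 1\<bar> * \<mu>\<^sup>2 + \<eta> * \<mu>\<^sup>2 + C * \<bar>r\<bar> powr p * \<nu>" for r
  have bound: "\<bar>expectation (\<lambda>x. \<bar>X x\<bar> powr p * \<bar>Y x\<bar> powr p) - \<mu>\<^sup>2\<bar> \<le> g r"
    if G: "std_gaussian_pair M r X Y" and r: "\<bar>r\<bar> < 1" for r X Y
  proof -
    have [measurable]: "random_variable borel X" "random_variable borel Y"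
      using G by (auto simp: std_gaussian_pair_def)
    have "r\<^sup>2 < 1" using r by (simp add: abs_square_less_1)
    then have s: "s r > 0" "s r \<le> 1" "(s r)\<^sup>2 = 1 - r\<^sup>2"
      by (auto simp: s_def)
    \<comment> \<open>\<open>Y = r X + s Z\<close> with \<open>Z\<close> independent of \<open>X\<close>; the term \<open>r X\<close> is a small perturbation.\<close>
    define Z where "Z x = (Y x - r * X x) / s r" for x
    have [measurable]: "random_variable borel Z" unfolding Z_def[abs_def] by measurable
    have Z: "std_gaussian_pair M 0 X Z"
      unfolding std_gaussian_pair_def
    proof (intro conjI allI)
      fix a b
      have lin: "a * X x + b * Z x = (a - b * r / s r) * X x + (b / s r) * Y x" for x
        using s by (simp add: Z_def field_simps)
      have var: "(a - b * r / s r)\<^sup>2 + 2 * r * (a - b * r / s r) * (b / s r) + (b / s r)\<^sup>2 = a\<^sup>2 + 2 * 0 * a * b + b\<^sup>2"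
      proof -
        have "(a - b * r / s r)\<^sup>2 + 2 * r * (a - b * r / s r) * (b / s r) + (b / s r)\<^sup>2 =
          a\<^sup>2 + b\<^sup>2 * (1 - r\<^sup>2) / (s r)\<^sup>2"
          using s(1) by (simp add: field_simps power2_eq_square)
        then show ?thesis using s(1) by (simp add: s(3)[symmetric])
      qed
      have "(CLINT x|M. iexp (u * X x + v * Y x)) = complex_of_real (exp (- (u\<^sup>2 + 2 * r * u * v + v\<^sup>2) / 2))" for u v
        using G unfolding std_gaussian_pair_def by blast
      then show "(CLINT x|M. iexp (a * X x + b * Z x)) =
          complex_of_real (exp (- (a\<^sup>2 + 2 * 0 * a * b + b\<^sup>2) / 2))"
        by (simp only: lin var[symmetric])
    qed auto
    have Y: "Y x = s r * Z x + r * X x" for x using s by (simp add: Z_def)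
    have iX: "integrable M (\<lambda>x. \<bar>X x\<bar> powr p)" "integrable M (\<lambda>x. \<bar>X x\<bar> powr (2*p))"
        "integrable M (\<lambda>x. \<bar>Z x\<bar> powr p)"
      using p std_gaussian_pair_integrable[OF G] std_gaussian_pair_integrable[OF std_gaussian_pair_sym[OF Z]] by auto
    have ind: "indep_var borel (\<lambda>x. \<bar>X x\<bar> powr p) borel (\<lambda>x. \<bar>Z x\<bar> powr p)"
      using indep_var_compose[OF std_gaussian_pair_indep_var[OF Z], of "\<lambda>x. \<bar>x\<bar> powr p" borel "\<lambda>x. \<bar>x\<bar> powr p" borel]
      by (simp add: comp_def)
    have iXZ: "integrable M (\<lambda>x. \<bar>X x\<bar> powr p * \<bar>Z x\<bar> powr p)"
      by (rule indep_var_integrable[OF ind iX(1,3)])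
    have eXZ: "expectation (\<lambda>x. \<bar>X x\<bar> powr p * \<bar>Z x\<bar> powr p) = \<mu>\<^sup>2"
      using indep_var_lebesgue_integral[OF ind iX(1,3)] p
        std_gaussian_pair_expectation[OF G, of p] std_gaussian_pair_expectation[OF std_gaussian_pair_sym[OF Z], of p]
      by (simp add: \<mu>_def power2_eq_square)
    have iXY: "integrable M (\<lambda>x. \<bar>X x\<bar> powr p * \<bar>Y x\<bar> powr p)"
      by (rule std_gaussian_pair_integrable_mult[OF G p])
    \<comment> \<open>The perturbation inequality with main part \<open>s r * Z x\<close> and error
      \<open>r * X x\<close>, multiplied by \<open>\<bar>X x\<bar> powr p\<close>. The products on
      the right have expectations that are known exactly: by independence of \<open>X\<close> and
      \<open>Z\<close>, and as the moment of order \<open>2 * p\<close>.\<close>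
    have pt: "\<bar>\<bar>X x\<bar> powr p * \<bar>Y x\<bar> powr p - s r powr p * (\<bar>X x\<bar> powr p * \<bar>Z x\<bar> powr p)\<bar> \<le>
        \<eta> * (\<bar>X x\<bar> powr p * \<bar>Z x\<bar> powr p) + C * \<bar>r\<bar> powr p * \<bar>X x\<bar> powr (2*p)" for x
    proof -
      have sp: "s r powr p \<le> 1" using s p by (simp add: powr_le1)
      have "\<bar>\<bar>Y x\<bar> powr p - \<bar>s r * Z x\<bar> powr p\<bar> \<le> \<eta> * \<bar>s r * Z x\<bar> powr p + C * \<bar>r * X x\<bar> powr p"
        unfolding Y by (rule C(2))
      also have "\<dots> \<le> \<eta> * \<bar>Z x\<bar> powr p + C * (\<bar>r\<bar> powr p * \<bar>X x\<bar> powr p)"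
        using s sp \<eta> by (simp add: abs_mult powr_mult mult_left_le_one_le)
      finally have "\<bar>X x\<bar> powr p * \<bar>\<bar>Y x\<bar> powr p - \<bar>s r * Z x\<bar> powr p\<bar> \<le>
          \<bar>X x\<bar> powr p * (\<eta> * \<bar>Z x\<bar> powr p + C * (\<bar>r\<bar> powr p * \<bar>X x\<bar> powr p))"
        by (intro mult_left_mono) auto
      also have "\<dots> = \<eta> * (\<bar>X x\<bar> powr p * \<bar>Z x\<bar> powr p) + C * \<bar>r\<bar> powr p * \<bar>X x\<bar> powr (2*p)"
        by (simp add: algebra_simps powr_add[symmetric])
      also have "\<bar>X x\<bar> powr p * \<bar>\<bar>Y x\<bar> powr p - \<bar>s r * Z x\<bar> powr p\<bar> =
          \<bar>\<bar>X x\<bar> powr p * (\<bar>Y x\<bar> powr p - \<bar>s r * Z x\<bar> powr p)\<bar>"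
        by (simp add: abs_mult)
      also have "\<bar>X x\<bar> powr p * (\<bar>Y x\<bar> powr p - \<bar>s r * Z x\<bar> powr p) =
          \<bar>X x\<bar> powr p * \<bar>Y x\<bar> powr p - s r powr p * (\<bar>X x\<bar> powr p * \<bar>Z x\<bar> powr p)"
        using s by (simp add: abs_mult powr_mult right_diff_distrib)
      finally show ?thesis .
    qed
    let ?D = "\<lambda>x. \<bar>X x\<bar> powr p * \<bar>Y x\<bar> powr p - s r powr p * (\<bar>X x\<bar> powr p * \<bar>Z x\<bar> powr p)"
    have D: "expectation (\<lambda>x. \<bar>X x\<bar> powr p * \<bar>Y x\<bar> powr p) - s r powr p * \<mu>\<^sup>2 =
        expectation ?D"
      using iXY iXZ by (simp add: eXZ)
    have "\<bar>expectation ?D\<bar> \<le> expectation (\<lambda>x. \<eta> * (\<bar>X x\<bar> powr p * \<bar>Z x\<bar> powr p) + C * \<bar>r\<bar> powr p * \<bar>X x\<bar> powr (2*p))"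
      using iXY iXZ iX(2) by (intro order_trans[OF integral_abs_bound] integral_mono pt) auto
    also have "\<dots> = \<eta> * \<mu>\<^sup>2 + C * \<bar>r\<bar> powr p * \<nu>"
      using iXZ iX(2) std_gaussian_pair_expectation[OF G, of "2*p"] p by (simp add: eXZ \<nu>_def)
    finally have "\<bar>expectation (\<lambda>x. \<bar>X x\<bar> powr p * \<bar>Y x\<bar> powr p) - s r powr p * \<mu>\<^sup>2\<bar> \<le> \<eta> * \<mu>\<^sup>2 + C * \<bar>r\<bar> powr p * \<nu>" unfolding D .
    moreover have "\<bar>s r powr p * \<mu>\<^sup>2 - \<mu>\<^sup>2\<bar> = \<bar>s r powr p - 1\<bar> * \<mu>\<^sup>2"
      using abs_mult[of "s r powr p - 1" "\<mu>\<^sup>2"] by (simp add: left_diff_distrib)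
    ultimately show ?thesis unfolding g_def by linarith
  qed
  have "g \<midarrow>0\<rightarrow> g 0"
    unfolding g_def s_def using p
    by (intro tendsto_add tendsto_mult tendsto_rabs tendsto_diff tendsto_const tendsto_powr'
        tendsto_real_sqrt tendsto_power tendsto_ident_at) auto
  moreover have "g 0 < \<epsilon>"
    using p \<mu> \<open>\<epsilon> > 0\<close> by (simp add: g_def s_def \<eta>_def)
  ultimately have "\<forall>\<^sub>F r in at 0. g r < \<epsilon>" by (rule order_tendstoD)
  \<comment> \<open>The filter \<open>at 0\<close> omits \<open>r = 0\<close>; that value is covered
    separately by \<open>g 0 < \<epsilon>\<close>.\<close>
  then obtain \<delta> where \<delta>: "\<delta> > 0" "\<And>r. r \<noteq> 0 \<Longrightarrow> \<bar>r\<bar> < \<delta> \<Longrightarrow> g r < \<epsilon>"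
    unfolding eventually_at by (auto simp: dist_real_def)
  have "\<bar>expectation (\<lambda>x. \<bar>X x\<bar> powr p * \<bar>Y x\<bar> powr p) - \<mu>\<^sup>2\<bar> < \<epsilon>"
    if "std_gaussian_pair M r X Y" "\<bar>r\<bar> < min \<delta> 1" for r X Y
    using bound[OF that(1)] \<delta>(2)[of r] that(2) \<open>g 0 < \<epsilon>\<close> by (cases "r = 0") auto
  then show thesis using that[of "min \<delta> 1"] \<delta>(1) unfolding \<mu>_def by auto
qed

end

section \<open>Limits in probability\<close>

lemma tendsto_in_prob_ereal_iff:
  "tendsto_in_prob M S (ereal c) \<longleftrightarrow> (\<forall>n. S n \<in> borel_measurable M) \<and>
     (\<forall>\<epsilon>>0. (\<lambda>n. measure M {x \<in> space M. \<bar>S n x - c\<bar> > \<epsilon>}) \<longlonglongrightarrow> 0)"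
  by (simp add: tendsto_in_prob_def)

context prob_space
begin

lemma tendsto_in_prob_if_AE:
  assumes [measurable]: "\<And>n. random_variable borel (S n)"
    and "AE x in M. (\<lambda>n. S n x) \<longlonglongrightarrow> c"
  shows "tendsto_in_prob M S (ereal c)"
  unfolding tendsto_in_prob_ereal_iff
proof (intro conjI allI impI)
  fix \<epsilon> :: real assume "\<epsilon> > 0"
  let ?A = "\<lambda>n. {x \<in> space M. \<bar>S n x - c\<bar> > \<epsilon>}"
  have "(\<lambda>n. expectation (indicator (?A n))) \<longlonglongrightarrow> expectation (\<lambda>x. 0 :: real)"
  proof (rule integral_dominated_convergence[where w="\<lambda>_. 1"])
    show "AE x in M. (\<lambda>n. indicator (?A n) x :: real) \<longlonglongrightarrow> 0"
      using assms(2)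
    proof eventually_elim
      case (elim x)
      have "\<forall>\<^sub>F n in sequentially. \<bar>S n x - c\<bar> < \<epsilon>"
        using tendstoD[OF elim \<open>\<epsilon> > 0\<close>] by (simp add: dist_real_def)
      then have "\<forall>\<^sub>F n in sequentially. indicator (?A n) x = (0 :: real)"
        by eventually_elim (auto simp: indicator_def)
      then show ?case by (rule tendsto_eventually)
    qed
  qed (auto simp: indicator_def)
  then show "(\<lambda>n. prob (?A n)) \<longlonglongrightarrow> 0" by simp
qed (use assms in auto)

lemma tendsto_in_prob_mult_const:
  assumes R: "tendsto_in_prob M R (ereal \<mu>)" and c: "c \<longlonglongrightarrow> c0"
  shows "tendsto_in_prob M (\<lambda>n x. c n * R n x) (ereal (c0 * \<mu>))"
  unfolding tendsto_in_prob_ereal_iff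
proof (intro conjI allI impI)
  have [measurable]: "random_variable borel (R n)" for n
    using R by (simp add: tendsto_in_prob_ereal_iff)
  show "(\<lambda>x. c n * R n x) \<in> borel_measurable M" for n by measurable
  fix \<epsilon> :: real assume \<epsilon>: "\<epsilon> > 0"
  define K where "K = \<bar>c0\<bar> + 1"
  have K: "K > 0" by (simp add: K_def)
  have "\<forall>\<^sub>F n in sequentially. \<bar>c n - c0\<bar> < 1"
    using tendstoD[OF c, of 1] by (simp add: dist_real_def)
  moreover have "(\<lambda>n. (c n - c0) * \<mu>) \<longlonglongrightarrow> 0"
    using c by (intro tendsto_mult_left_zero) (simp add: LIM_zero)
  then have "\<forall>\<^sub>F n in sequentially. \<bar>(c n - c0) * \<mu>\<bar> < \<epsilon> / 2"
    using \<epsilon> by (auto simp: tendsto_iff dist_real_def dest: spec[of _ "\<epsilon> / 2"])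
  ultimately have "\<forall>\<^sub>F n in sequentially. norm (prob {x \<in> space M. \<bar>c n * R n x - c0 * \<mu>\<bar> > \<epsilon>}) \<le>
      norm (prob {x \<in> space M. \<bar>R n x - \<mu>\<bar> > \<epsilon> / (2 * K)}) * 1"
  proof eventually_elim
    case (elim n)
    have "\<bar>R n x - \<mu>\<bar> > \<epsilon> / (2 * K)" if "\<bar>c n * R n x - c0 * \<mu>\<bar> > \<epsilon>" for x
    proof -
      have "c n * R n x - c0 * \<mu> = c n * (R n x - \<mu>) + (c n - c0) * \<mu>"
        by (simp add: algebra_simps)
      then have "\<epsilon> / 2 < \<bar>c n\<bar> * \<bar>R n x - \<mu>\<bar>"
        using that elim(2) by (simp add: abs_mult[symmetric])
      also have "\<dots> \<le> K * \<bar>R n x - \<mu>\<bar>"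
        using elim(1) by (intro mult_right_mono) (auto simp: K_def)
      finally show ?thesis using K by (simp add: field_simps)
    qed
    then show ?case by (auto intro!: finite_measure_mono)
  qed
  moreover have "(\<lambda>n. prob {x \<in> space M. \<bar>R n x - \<mu>\<bar> > \<epsilon> / (2 * K)}) \<longlonglongrightarrow> 0"
    using R \<epsilon> K by (simp add: tendsto_in_prob_ereal_iff)
  ultimately show "(\<lambda>n. prob {x \<in> space M. \<bar>c n * R n x - c0 * \<mu>\<bar> > \<epsilon>}) \<longlonglongrightarrow> 0"
    by (intro tendsto_0_le[where K=1 and g="\<lambda>n. prob {x \<in> space M. \<bar>c n * R n x - c0 * \<mu>\<bar> > \<epsilon>}"])
qed

text \<open>Off an event of vanishing probability \<open>R n x\<close> is at least
  \<open>\<mu> / 2\<close>, so the product is at least \<open>c n * \<mu> / 2\<close> once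
  \<open>c n\<close> is positive.\<close>

lemma tendsto_in_prob_mult_at_top:
  assumes R: "tendsto_in_prob M R (ereal \<mu>)" and "\<mu> > 0" and c: "filterlim c at_top sequentially"
  shows "tendsto_in_prob M (\<lambda>n x. c n * R n x) \<infinity>"
proof -
  have [measurable]: "random_variable borel (R n)" for n
    using R by (simp add: tendsto_in_prob_ereal_iff)
  have "(\<lambda>n. prob {x \<in> space M. c n * R n x > K}) \<longlonglongrightarrow> 1" for K
  proof (rule tendsto_sandwich[where h="\<lambda>_. 1"])
    let ?B = "\<lambda>n. {x \<in> space M. \<bar>R n x - \<mu>\<bar> > \<mu> / 2}"
    have "(\<lambda>n. prob (?B n)) \<longlonglongrightarrow> 0"
      using R half_gt_zero[OF \<open>\<mu> > 0\<close>] unfolding tendsto_in_prob_ereal_iff by blast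
    then have "(\<lambda>n. 1 - prob (?B n)) \<longlonglongrightarrow> 1 - 0"
      by (intro tendsto_intros)
    then show "(\<lambda>n. 1 - prob (?B n)) \<longlonglongrightarrow> 1" by simp
    have "\<forall>\<^sub>F n in sequentially. c n > max 0 (2 * K / \<mu>)"
      using c unfolding filterlim_at_top_dense by blast
    then show "\<forall>\<^sub>F n in sequentially. 1 - prob (?B n) \<le> prob {x \<in> space M. c n * R n x > K}"
    proof eventually_elim
      case (elim n)
      have "K < c n * R n x" if "\<not> \<bar>R n x - \<mu>\<bar> > \<mu> / 2" for x
      proof -
        have "\<mu> / 2 \<le> R n x" using that by linarith
        then have "c n * (\<mu> / 2) \<le> c n * R n x"
          using elim by (intro mult_left_mono) auto
        moreover have "K < c n * (\<mu> / 2)" using elim \<open>\<mu> > 0\<close> by (simp add: field_simps)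
        ultimately show ?thesis by simp
      qed
      then have "prob (space M - ?B n) \<le> prob {x \<in> space M. c n * R n x > K}"
        by (intro finite_measure_mono) auto
      then show ?case by (subst (asm) prob_compl) auto
    qed
  qed (auto intro!: always_eventually)
  then show ?thesis unfolding tendsto_in_prob_def by simp
qed

text \<open>Averaging the perturbation inequality bounds the change of the mean by \<eta> times the
  old mean plus \<open>C\<close> times the mean of the errors. The old mean is close to \<mu> in
  probability, so \<eta> can be fixed first; \<open>C\<close> is then a constant, and the error mean
  tends to \<open>0\<close>.\<close>

lemma tendsto_in_prob_mean_abs_powr_perturb:
  fixes Y E :: "nat \<Rightarrow> nat \<Rightarrow> 'a \<Rightarrow> real"
  assumes p: "p > 0" and "\<mu> > 0"
    and [measurable]: "\<And>n k. random_variable borel (Y n k)" "\<And>n k. random_variable borel (E n k)"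
    and Y: "tendsto_in_prob M (\<lambda>n x. (\<Sum>k=1..n. \<bar>Y n k x\<bar> powr p) / real n) (ereal \<mu>)"
    and E: "tendsto_in_prob M (\<lambda>n x. (\<Sum>k=1..n. \<bar>E n k x\<bar> powr p) / real n) (ereal 0)"
  shows "tendsto_in_prob M (\<lambda>n x. (\<Sum>k=1..n. \<bar>Y n k x + E n k x\<bar> powr p) / real n) (ereal \<mu>)"
  unfolding tendsto_in_prob_ereal_iff
proof (intro conjI allI impI)
  define R where "R n x = (\<Sum>k=1..n. \<bar>Y n k x\<bar> powr p) / real n" for n x
  define D where "D n x = (\<Sum>k=1..n. \<bar>E n k x\<bar> powr p) / real n" for n x
  have [measurable]: "random_variable borel (R n)" "random_variable borel (D n)" for n
    unfolding R_def[abs_def] D_def[abs_def] by measurable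
  fix \<epsilon> :: real assume \<epsilon>: "\<epsilon> > 0"
  \<comment> \<open>The budget is \<open>\<eta> * \<mu> \<le> \<epsilon> / 3\<close>, two errors of
    \<open>\<epsilon> / 6\<close> from \<open>R n x - \<mu>\<close>, and
    \<open>\<epsilon> / 3\<close> from the perturbation. The bound \<open>\<eta> \<le> 1\<close>
    keeps \<open>\<eta> * (R n x - \<mu>)\<close> below \<open>\<epsilon> / 6\<close>.\<close>
  define \<eta> where "\<eta> = min 1 (\<epsilon> / (3 * \<mu>))"
  have \<eta>: "\<eta> > 0" "\<eta> \<le> 1" "\<eta> * \<mu> \<le> \<epsilon> / 3" using \<epsilon> \<open>\<mu> > 0\<close> by (auto simp: \<eta>_def min_def field_simps)
  obtain C where C: "C > 0"
    "\<And>y e. \<bar>\<bar>y + e\<bar> powr p - \<bar>y\<bar> powr p\<bar> \<le> \<eta> * \<bar>y\<bar> powr p + C * \<bar>e\<bar> powr p"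
    using abs_powr_add_diff_le[OF p \<eta>(1)] by blast
  let ?S = "\<lambda>n x. (\<Sum>k=1..n. \<bar>Y n k x + E n k x\<bar> powr p) / real n"
  let ?B = "\<lambda>n. {x \<in> space M. \<bar>?S n x - \<mu>\<bar> > \<epsilon>}"
  let ?B1 = "\<lambda>n. {x \<in> space M. \<bar>R n x - \<mu>\<bar> > \<epsilon> / 6}"
  let ?B2 = "\<lambda>n. {x \<in> space M. \<bar>D n x - 0\<bar> > \<epsilon> / (3 * C)}"
  have "\<bar>?S n x - R n x\<bar> \<le> \<eta> * R n x + C * D n x" for n x
  proof -
    have "\<bar>?S n x - R n x\<bar> = \<bar>\<Sum>k=1..n. \<bar>Y n k x + E n k x\<bar> powr p - \<bar>Y n k x\<bar> powr p\<bar> / n"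
      by (simp add: R_def sum_subtractf flip: diff_divide_distrib)
    also have "\<dots> \<le> (\<Sum>k=1..n. \<eta> * \<bar>Y n k x\<bar> powr p + C * \<bar>E n k x\<bar> powr p) / n"
      by (intro divide_right_mono order_trans[OF sum_abs] sum_mono C) auto
    also have "\<dots> = \<eta> * R n x + C * D n x"
      by (simp add: R_def D_def sum.distrib sum_distrib_left add_divide_distrib)
    finally show ?thesis .
  qed
  then have "?B n \<subseteq> ?B1 n \<union> ?B2 n" for n
  proof (intro subsetI)
    fix x assume *: "\<And>n x. \<bar>?S n x - R n x\<bar> \<le> \<eta> * R n x + C * D n x" and x: "x \<in> ?B n"
    show "x \<in> ?B1 n \<union> ?B2 n"
    proof (rule ccontr)
      assume "x \<notin> ?B1 n \<union> ?B2 n"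
      then have 1: "\<bar>R n x - \<mu>\<bar> \<le> \<epsilon> / 6" and 2: "D n x \<le> \<epsilon> / (3 * C)" using x by auto
      have "C * D n x \<le> \<epsilon> / 3" using 2 C by (simp add: field_simps)
      moreover have "\<eta> * R n x \<le> \<eta> * \<mu> + \<epsilon> / 6"
      proof -
        have "R n x - \<mu> \<le> \<epsilon> / 6" using 1 by linarith
        then have "\<eta> * (R n x - \<mu>) \<le> \<eta> * (\<epsilon> / 6)"
          using \<eta>(1) by (intro mult_left_mono) auto
        also have "\<dots> \<le> 1 * (\<epsilon> / 6)"
          using \<eta> \<epsilon> by (intro mult_right_mono) auto
        finally show ?thesis by (simp add: algebra_simps)
      qed
      moreover have "\<epsilon> < \<bar>?S n x - \<mu>\<bar>" using x by simp
      ultimately show False using *[of n x] 1 \<eta>(3) by linarith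
    qed
  qed
  then have le: "prob (?B n) \<le> prob (?B1 n) + prob (?B2 n)" for n
    by (intro order_trans[OF finite_measure_mono measure_Un_le]) auto
  have lim: "(\<lambda>n. prob (?B1 n) + prob (?B2 n)) \<longlonglongrightarrow> 0 + 0"
  proof (rule tendsto_add)
    have *: "\<And>e. e > 0 \<Longrightarrow> (\<lambda>n. prob {x \<in> space M. \<bar>R n x - \<mu>\<bar> > e}) \<longlonglongrightarrow> 0"
        "\<And>e. e > 0 \<Longrightarrow> (\<lambda>n. prob {x \<in> space M. \<bar>D n x - 0\<bar> > e}) \<longlonglongrightarrow> 0"
      using Y E unfolding tendsto_in_prob_ereal_iff R_def D_def by blast+
    show "(\<lambda>n. prob (?B1 n)) \<longlonglongrightarrow> 0" "(\<lambda>n. prob (?B2 n)) \<longlonglongrightarrow> 0"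
      using \<epsilon> C(1) by (intro *; simp)+
  qed
  show "(\<lambda>n. prob (?B n)) \<longlonglongrightarrow> 0"
    by (intro tendsto_sandwich[OF _ _ tendsto_const lim[unfolded add_0]]) (use le in auto)
qed measurable

text \<open>A weak law for triangular arrays by Chebyshev's inequality. The lag \<open>J\<close>
  beyond which pairs are nearly uncorrelated does not depend on \<open>n\<close>, so each row of the
  covariance matrix has at most \<open>2 * J\<close> entries that are not small. They contribute at
  most \<open>2 * K * J / n\<close> to the variance of the mean, and the remaining entries at most
  \<epsilon>.\<close>

lemma std_gaussian_array_mean_abs_powr:
  fixes Y :: "nat \<Rightarrow> nat \<Rightarrow> 'a \<Rightarrow> real" and \<rho> :: "nat \<Rightarrow> nat \<Rightarrow> nat \<Rightarrow> real"
  assumes p: "p > 0" and Y [measurable]: "\<And>n k. random_variable borel (Y n k)"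
    and G: "\<And>n j k. \<lbrakk>1 \<le> j; j \<le> k; k \<le> n\<rbrakk> \<Longrightarrow> std_gaussian_pair M (\<rho> n j k) (Y n j) (Y n k)"
    and \<rho>: "\<And>\<delta>. \<delta> > 0 \<Longrightarrow> \<exists>J. \<forall>n j k. 1 \<le> j \<longrightarrow> j + J \<le> k \<longrightarrow> k \<le> n \<longrightarrow> \<bar>\<rho> n j k\<bar> < \<delta>"
  shows "tendsto_in_prob M (\<lambda>n x. (\<Sum>k=1..n. \<bar>Y n k x\<bar> powr p) / real n)
    (ereal (gaussian_abs_moment p))"
  unfolding tendsto_in_prob_ereal_iff
proof (intro conjI allI impI)
  define \<mu> where "\<mu> = gaussian_abs_moment p"
  define K where "K = gaussian_abs_moment (2 * p)"
  have K: "K > 0" using p by (simp add: K_def gaussian_abs_moment_pos)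
  define R where "R n x = (\<Sum>k=1..n. \<bar>Y n k x\<bar> powr p) / real n" for n x
  have [measurable]: "random_variable borel (R n)" for n
    unfolding R_def[abs_def] by measurable
  have G': "std_gaussian_pair M (\<rho> n (min j k) (max j k)) (Y n j) (Y n k)"
    if "1 \<le> j" "j \<le> n" "1 \<le> k" "k \<le> n" for n j k
    using G[of j k n] G[of k j n] that std_gaussian_pair_sym
    by (cases "j \<le> k") (auto simp: min_def max_def)
  note int1 = std_gaussian_pair_integrable[OF G', of _ _ _ p]
  note exp1 = std_gaussian_pair_expectation[OF G', of _ _ _ p, folded \<mu>_def]
  note int2 = std_gaussian_pair_integrable_mult[OF G' p]
  define a where "a n j k = expectation (\<lambda>x. \<bar>Y n j x\<bar> powr p * \<bar>Y n k x\<bar> powr p) - \<mu>\<^sup>2" for n j k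
  have R_mean: "expectation (R n) = \<mu>" if "n \<ge> 1" for n
  proof -
    have "expectation (R n) = (\<Sum>k=1..n. expectation (\<lambda>x. \<bar>Y n k x\<bar> powr p)) / n"
      unfolding R_def[abs_def] using p int1 by (subst integral_divide_zero, subst Bochner_Integration.integral_sum) auto
    also have "\<dots> = \<mu>" using that p by (simp add: exp1)
    finally show ?thesis .
  qed
  have R_sq: "(R n x)\<^sup>2 = (\<Sum>j=1..n. \<Sum>k=1..n. \<bar>Y n j x\<bar> powr p * \<bar>Y n k x\<bar> powr p) / n\<^sup>2" for n x
    by (simp add: R_def power_divide power2_eq_square sum_product)
  have int_R_sq: "integrable M (\<lambda>x. (R n x)\<^sup>2)" for n
    unfolding R_sq by (intro integrable_divide_zero Bochner_Integration.integrable_sum impI int2) auto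
  have R_var: "variance (R n) = (\<Sum>j=1..n. \<Sum>k=1..n. a n j k) / n\<^sup>2" if "n \<ge> 1" for n
  proof -
    have "variance (R n) = expectation (\<lambda>x. (R n x)\<^sup>2) - \<mu>\<^sup>2"
      using that by (subst variance_eq) (auto simp: R_mean int_R_sq intro: square_integrable_imp_integrable)
    also have "expectation (\<lambda>x. (R n x)\<^sup>2) =
        (\<Sum>j=1..n. \<Sum>k=1..n. expectation (\<lambda>x. \<bar>Y n j x\<bar> powr p * \<bar>Y n k x\<bar> powr p)) / n\<^sup>2"
    proof -
      have "expectation (\<lambda>x. \<Sum>j=1..n. \<Sum>k=1..n. \<bar>Y n j x\<bar> powr p * \<bar>Y n k x\<bar> powr p) =
          (\<Sum>j=1..n. expectation (\<lambda>x. \<Sum>k=1..n. \<bar>Y n j x\<bar> powr p * \<bar>Y n k x\<bar> powr p))"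
        by (intro Bochner_Integration.integral_sum Bochner_Integration.integrable_sum int2) auto
      also have "\<dots> = (\<Sum>j=1..n. \<Sum>k=1..n. expectation (\<lambda>x. \<bar>Y n j x\<bar> powr p * \<bar>Y n k x\<bar> powr p))"
        by (intro sum.cong refl Bochner_Integration.integral_sum int2) auto
      finally show ?thesis unfolding R_sq by simp
    qed
    also have "\<dots> = (\<Sum>j=1..n. \<Sum>k=1..n. a n j k) / n\<^sup>2 + \<mu>\<^sup>2"
      using that by (simp add: a_def sum_subtractf field_simps power2_eq_square)
    finally show ?thesis by simp
  qed
  have var_lim: "(\<lambda>n. variance (R n)) \<longlonglongrightarrow> 0"
  proof (rule LIMSEQ_I)
    fix e :: real assume "e > 0"
    define \<epsilon> where "\<epsilon> = e / 2"
    have \<epsilon>: "\<epsilon> > 0" using \<open>e > 0\<close> by (simp add: \<epsilon>_def)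
    obtain \<delta> where \<delta>: "\<delta> > 0" "\<And>r X Y. std_gaussian_pair M r X Y \<Longrightarrow> \<bar>r\<bar> < \<delta> \<Longrightarrow>
        \<bar>expectation (\<lambda>x. \<bar>X x\<bar> powr p * \<bar>Y x\<bar> powr p) - \<mu>\<^sup>2\<bar> < \<epsilon>"
      using std_gaussian_pair_abs_powr_cov[OF p \<epsilon>] unfolding \<mu>_def by blast
    obtain J where J: "\<And>n j k. \<lbrakk>1 \<le> j; j + J \<le> k; k \<le> n\<rbrakk> \<Longrightarrow> \<bar>\<rho> n j k\<bar> < \<delta>"
      using \<rho>[OF \<delta>(1)] by blast
    \<comment> \<open>The subtraction \<open>j - J\<close> is truncated, but outside the band the
      lag is still at least \<open>J\<close>: when it is cut off at \<open>0\<close>, only indices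
      above the band remain.\<close>
    have a_le: "a n j k \<le> \<epsilon> + K * indicator {j - J..<j + J} k"
      if "1 \<le> j" "j \<le> n" "1 \<le> k" "k \<le> n" for n j k
    proof (cases "k \<in> {j - J..<j + J}")
      case True
      have "a n j k \<le> K - \<mu>\<^sup>2"
        unfolding a_def K_def using std_gaussian_pair_abs_powr_mult(2)[OF G' p] that by auto
      then show ?thesis using zero_le_power2[of \<mu>] \<epsilon> unfolding indicator_simps(1)[OF True] by linarith
    next
      case False
      then have "min j k + J \<le> max j k" by auto
      then have "\<bar>\<rho> n (min j k) (max j k)\<bar> < \<delta>" using that by (intro J) auto
      then have "a n j k < \<epsilon>" unfolding a_def using \<delta>(2)[OF G'[OF that]] by (simp add: abs_less_iff)
      then show ?thesis using False by simp
    qed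
    have var_le: "variance (R n) \<le> \<epsilon> + 2 * K * J / n" if "n \<ge> 1" for n
    proof -
      have sum_ind: "(\<Sum>k\<in>A. indicator S k :: real) = card (A \<inter> S)" if "finite A" for A S :: "nat set"
        using that by (simp add: indicator_def sum.If_cases Int_def)
      have "(\<Sum>k=1..n. a n j k) \<le> n * \<epsilon> + 2 * K * J" if j: "j \<in> {1..n}" for j
      proof -
        have "(\<Sum>k=1..n. a n j k) \<le> (\<Sum>k=1..n. \<epsilon> + K * indicator {j - J..<j + J} k)"
          using j by (intro sum_mono a_le) auto
        also have "\<dots> = n * \<epsilon> + K * card ({1..n} \<inter> {j - J..<j + J})"
          by (simp add: sum.distrib sum_distrib_left[symmetric] sum_ind)
        also have "\<dots> \<le> n * \<epsilon> + K * (2 * J)"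
        proof -
          have "card ({1..n} \<inter> {j - J..<j + J}) \<le> card {j - J..<j + J}"
            by (intro card_mono) auto
          also have "\<dots> \<le> 2 * J" by simp
          finally show ?thesis using K by (intro add_left_mono mult_left_mono) simp_all
        qed
        finally show ?thesis by (simp add: mult_ac)
      qed
      then have "(\<Sum>j=1..n. \<Sum>k=1..n. a n j k) \<le> (\<Sum>j=1..n. n * \<epsilon> + 2 * K * J)"
        by (intro sum_mono) auto
      then have "(\<Sum>j=1..n. \<Sum>k=1..n. a n j k) / n\<^sup>2 \<le> n * (n * \<epsilon> + 2 * K * J) / n\<^sup>2"
        by (intro divide_right_mono) auto
      also have "\<dots> = \<epsilon> + 2 * K * J / n"
        using that by (simp add: power2_eq_square field_simps)
      finally show ?thesis using R_var[OF that] by simp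
    qed
    have "(\<lambda>n. \<epsilon> + 2 * K * J / real n) \<longlonglongrightarrow> \<epsilon> + 0"
      by (intro tendsto_intros lim_const_over_n)
    then have "\<forall>\<^sub>F n in sequentially. \<epsilon> + 2 * K * J / real n < e"
      using \<open>e > 0\<close> by (elim order_tendstoD(2)) (simp add: \<epsilon>_def)
    then have "\<forall>\<^sub>F n in sequentially. norm (variance (R n) - 0) < e"
      using eventually_ge_at_top[of 1]
    proof eventually_elim
      case (elim n)
      then show ?case using var_le[of n] variance_positive[of "R n"] by simp
    qed
    then show "\<exists>N. \<forall>n\<ge>N. norm (variance (R n) - 0) < e"
      by (simp add: eventually_sequentially)
  qed
  fix \<epsilon> :: real assume \<epsilon>: "\<epsilon> > 0"
  have "(\<lambda>n. variance (R n) / \<epsilon>\<^sup>2) \<longlonglongrightarrow> 0 / \<epsilon>\<^sup>2"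
    using \<epsilon> by (intro tendsto_intros var_lim) auto
  moreover have "\<forall>\<^sub>F n in sequentially. prob {x \<in> space M. \<bar>R n x - \<mu>\<bar> > \<epsilon>} \<le> variance (R n) / \<epsilon>\<^sup>2"
    using eventually_ge_at_top[of 1]
  proof eventually_elim
    case (elim n)
    have "prob {x \<in> space M. \<bar>R n x - \<mu>\<bar> > \<epsilon>} \<le> prob {x \<in> space M. \<bar>R n x - \<mu>\<bar> \<ge> \<epsilon>}"
      by (intro finite_measure_mono) auto
    also have "\<dots> \<le> variance (R n) / \<epsilon>\<^sup>2"
      using Chebyshev_inequality[OF _ int_R_sq \<epsilon>, of n] R_mean[OF elim] by simp
    finally show ?case .
  qed
  ultimately have "(\<lambda>n. prob {x \<in> space M. \<bar>R n x - \<mu>\<bar> > \<epsilon>}) \<longlonglongrightarrow> 0"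
    by (auto intro: tendsto_sandwich[OF _ _ tendsto_const[of 0], where h="\<lambda>n. variance (R n) / \<epsilon>\<^sup>2"])
  then show "(\<lambda>n. prob {x \<in> space M. \<bar>(\<Sum>k=1..n. \<bar>Y n k x\<bar> powr p) / real n - gaussian_abs_moment p\<bar> > \<epsilon>})
      \<longlonglongrightarrow> 0"
    by (simp add: R_def \<mu>_def)
qed measurable

end

section \<open>Fractional Brownian motion\<close>

definition fBM_cov :: "real \<Rightarrow> real \<Rightarrow> real \<Rightarrow> real" where
  "fBM_cov H t s = (\<bar>t\<bar> powr (2 * H) + \<bar>s\<bar> powr (2 * H) - \<bar>t - s\<bar> powr (2 * H)) / 2"

text \<open>Half the second difference of \<open>\<bar>d\<bar> powr (2 * H)\<close>: the covariance
  of two unit-length increments of fractional Brownian motion at lag \<open>d\<close>.\<close>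

definition fGN_cov :: "real \<Rightarrow> real \<Rightarrow> real" where
  "fGN_cov H d = (\<bar>d + 1\<bar> powr (2 * H) + \<bar>d - 1\<bar> powr (2 * H) - 2 * \<bar>d\<bar> powr (2 * H)) / 2"

text \<open>The variance of \<open>\<Sum>t\<in>F. c t * B t\<close> for a fractional Brownian motion
  \<open>B\<close> of index \<open>H\<close>.\<close>

definition fBM_quad :: "real \<Rightarrow> real set \<Rightarrow> (real \<Rightarrow> real) \<Rightarrow> real" where
  "fBM_quad H F c = (\<Sum>t\<in>F. \<Sum>s\<in>F. c t * c s * fBM_cov H t s)"

text \<open>A bound free of \<open>H\<close>: it lets the series over all components be dominated by
  a multiple of \<open>\<Sum>k. (\<sigma> k)\<^sup>2\<close>.\<close>

lemma abs_powr_le_one_plus_square: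
  fixes H x :: real
  assumes "0 < H" "H < 1"
  shows "\<bar>x\<bar> powr (2 * H) \<le> 1 + x\<^sup>2"
proof (cases "\<bar>x\<bar> \<le> 1")
  case True
  then have "\<bar>x\<bar> powr (2 * H) \<le> 1" using assms by (simp add: powr_le1)
  then show ?thesis by (simp add: add_increasing2)
next
  case False
  then have "\<bar>x\<bar> powr (2 * H) \<le> \<bar>x\<bar> powr 2" using assms by (intro powr_mono) auto
  also have "\<dots> = x\<^sup>2" using False by simp
  finally show ?thesis by simp
qed

lemma abs_fBM_cov_le:
  assumes "0 < H" "H < 1"
  shows "\<bar>fBM_cov H t s\<bar> \<le> 3 + t\<^sup>2 + s\<^sup>2 + (t - s)\<^sup>2"
proof -
  have "\<bar>(a + b - c) / 2\<bar> \<le> a + b + c" if "0 \<le> a" "0 \<le> b" "0 \<le> c" for a b c :: real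
    using that by (simp add: abs_le_iff)
  then have "\<bar>fBM_cov H t s\<bar> \<le> \<bar>t\<bar> powr (2 * H) + \<bar>s\<bar> powr (2 * H) + \<bar>t - s\<bar> powr (2 * H)"
    unfolding fBM_cov_def by simp
  also have "\<dots> \<le> (1 + t\<^sup>2) + (1 + s\<^sup>2) + (1 + (t - s)\<^sup>2)"
    by (intro add_mono abs_powr_le_one_plus_square assms)
  finally show ?thesis by simp
qed

text \<open>The mean value theorem for each of the two first differences, then once more for the
  difference of their derivatives. The intermediate points \<open>x1\<close> and \<open>x2\<close>
  lie between \<open>d - 1\<close> and \<open>d + 1\<close>, which gives both the factor
  \<open>2\<close> and the shifted argument \<open>d - 1\<close>, the exponent
  \<open>2 * H - 2\<close> being negative. The remaining factors \<open>\<alpha> / 2\<close> and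
  \<open>\<bar>\<alpha> - 1\<bar>\<close> are at most \<open>1\<close>.\<close>

lemma abs_fGN_cov_le:
  assumes H: "0 < H" "H < 1" and d: "d > 1"
  shows "\<bar>fGN_cov H d\<bar> \<le> 2 * (d - 1) powr (2 * H - 2)"
proof -
  define \<alpha> where "\<alpha> = 2 * H"
  have \<alpha>: "0 < \<alpha>" "\<alpha> < 2" using H by (auto simp: \<alpha>_def)
  have der: "((\<lambda>x. x powr \<beta>) has_real_derivative \<beta> * x powr (\<beta> - 1)) (at x)" if "x > 0" for x \<beta> :: real
    using that by (auto intro!: derivative_eq_intros)
  obtain x1 where x1: "d < x1" "x1 < d + 1" "(d + 1) powr \<alpha> - d powr \<alpha> = \<alpha> * x1 powr (\<alpha> - 1)"
    using MVT2[of d "d + 1" "\<lambda>x. x powr \<alpha>" "\<lambda>x. \<alpha> * x powr (\<alpha> - 1)"] der d by auto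
  obtain x2 where x2: "d - 1 < x2" "x2 < d" "d powr \<alpha> - (d - 1) powr \<alpha> = \<alpha> * x2 powr (\<alpha> - 1)"
    using MVT2[of "d - 1" d "\<lambda>x. x powr \<alpha>" "\<lambda>x. \<alpha> * x powr (\<alpha> - 1)"] der d by auto
  obtain x3 where x3: "x2 < x3" "x3 < x1"
      "x1 powr (\<alpha> - 1) - x2 powr (\<alpha> - 1) = (x1 - x2) * ((\<alpha> - 1) * x3 powr (\<alpha> - 2))"
    using MVT2[of x2 x1 "\<lambda>x. x powr (\<alpha> - 1)" "\<lambda>x. (\<alpha> - 1) * x powr (\<alpha> - 2)"] der[of _ "\<alpha> - 1"] d x1 x2
    by (auto simp: algebra_simps)
  have "fGN_cov H d = ((d + 1) powr \<alpha> - d powr \<alpha> - (d powr \<alpha> - (d - 1) powr \<alpha>)) / 2"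
    using d by (simp add: fGN_cov_def \<alpha>_def)
  also have "\<dots> = \<alpha> * (x1 powr (\<alpha> - 1) - x2 powr (\<alpha> - 1)) / 2"
    unfolding x1(3) x2(3) by (simp add: algebra_simps)
  also have "\<dots> = (\<alpha> / 2) * (x1 - x2) * (\<alpha> - 1) * x3 powr (\<alpha> - 2)"
    unfolding x3(3) by simp
  finally have eq: "fGN_cov H d = (\<alpha> / 2) * (x1 - x2) * (\<alpha> - 1) * x3 powr (\<alpha> - 2)" .
  have "\<bar>fGN_cov H d\<bar> = \<bar>\<alpha> / 2\<bar> * \<bar>x1 - x2\<bar> * \<bar>\<alpha> - 1\<bar> * x3 powr (\<alpha> - 2)"
    unfolding eq by (simp add: abs_mult)
  also have "\<dots> \<le> 1 * 2 * 1 * (d - 1) powr (\<alpha> - 2)"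
    using \<alpha> x1 x2 x3 d by (intro mult_mono powr_mono2') auto
  finally show ?thesis by (simp add: \<alpha>_def)
qed

text \<open>One choice of \<open>F\<close> and \<open>c\<close>, independent of \<open>H\<close>,
  represents the combination of two increments. The same linear functional can therefore be applied
  to every component and to the limit, and the variances can be summed over components.\<close>

lemma fBM_quad_increments:
  assumes h: "h > 0" and "1 \<le> j" "j \<le> k"
  obtains F c where "finite F"
    "\<And>g. (\<Sum>t\<in>F. c t * g t) = a * (g (real j * h) - g (real (j - 1) * h)) +
       b * (g (real k * h) - g (real (k - 1) * h))"
    "\<And>H. 0 < H \<Longrightarrow> fBM_quad H F c = h powr (2 * H) * (a\<^sup>2 + 2 * fGN_cov H (real k - real j) * a * b + b\<^sup>2)"
proof -
  define t0 t1 t2 t3 where "t0 = real (j - 1) * h" "t1 = real j * h" "t2 = real (k - 1) * h" "t3 = real k * h"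
  note t = this
  define F where "F = {t0, t1, t2, t3}"
  \<comment> \<open>The time points may coincide, for \<open>k = j\<close> or
    \<open>k = j + 1\<close>. Adding indicators accumulates the coefficients at common points
    without a case distinction.\<close>
  define c :: "real \<Rightarrow> real" where "c t = a * (of_bool (t = t1) - of_bool (t = t0)) +
      b * (of_bool (t = t3) - of_bool (t = t2))" for t
  have "finite F" by (simp add: F_def)
  have lin: "(\<Sum>t\<in>F. c t * g t) = a * (g t1 - g t0) + b * (g t3 - g t2)" for g :: "real \<Rightarrow> real"
  proof -
    have single: "(\<Sum>t\<in>F. of_bool (t = u) * g t) = g u" if "u \<in> F" for u
    proof -
      have "(\<Sum>t\<in>F. of_bool (t = u) * g t) = (\<Sum>t\<in>F. if u = t then g t else 0)"
        by (intro sum.cong) auto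
      then show ?thesis using that \<open>finite F\<close> by simp
    qed
    have "(\<Sum>t\<in>F. c t * g t) = (\<Sum>t\<in>F. a * (of_bool (t = t1) * g t) - a * (of_bool (t = t0) * g t) +
        (b * (of_bool (t = t3) * g t) - b * (of_bool (t = t2) * g t)))"
      by (intro sum.cong) (simp_all add: c_def algebra_simps)
    also have "\<dots> = a * g t1 - a * g t0 + (b * g t3 - b * g t2)"
      unfolding sum.distrib sum_subtractf sum_distrib_left[symmetric]
      using single[of t0] single[of t1] single[of t2] single[of t3] by (simp add: F_def)
    finally show ?thesis by (simp add: algebra_simps)
  qed
  have "fBM_quad H F c = h powr (2 * H) * (a\<^sup>2 + 2 * fGN_cov H (real k - real j) * a * b + b\<^sup>2)" if "0 < H" for H
  proof -
    define R where "R = fBM_cov H"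
    define q where "q t = \<bar>t\<bar> powr (2 * H)" for t :: real
    define D where "D t s = \<bar>t - s\<bar> powr (2 * H)" for t s :: real
    have R: "R t s = (q t + q s - D t s) / 2" for t s by (simp add: R_def fBM_cov_def q_def D_def)
    have D: "D t t = 0" "D t s = D s t" for t s by (simp_all add: D_def abs_minus_commute)
    note sym = D(2)[of t0 t1] D(2)[of t0 t2] D(2)[of t0 t3] D(2)[of t1 t2] D(2)[of t1 t3] D(2)[of t2 t3]
    have "fBM_quad H F c = (\<Sum>t\<in>F. c t * (\<Sum>s\<in>F. c s * R t s))"
      unfolding fBM_quad_def R_def by (simp add: sum_distrib_left mult.assoc)
    also have "\<dots> = a * ((a * (R t1 t1 - R t1 t0) + b * (R t1 t3 - R t1 t2)) -
          (a * (R t0 t1 - R t0 t0) + b * (R t0 t3 - R t0 t2))) +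
        b * ((a * (R t3 t1 - R t3 t0) + b * (R t3 t3 - R t3 t2)) -
          (a * (R t2 t1 - R t2 t0) + b * (R t2 t3 - R t2 t2)))"
      unfolding lin ..
    \<comment> \<open>The terms \<open>q\<close> depend on one variable only and cancel under
      differencing in both variables; only the distances \<open>D\<close> survive.\<close>
    also have "\<dots> = a\<^sup>2 * D t1 t0 + b\<^sup>2 * D t3 t2 + a * b * (D t3 t0 + D t2 t1 - D t3 t1 - D t2 t0)"
      unfolding R sym D(1) by (simp add: field_simps power2_eq_square)
    finally have "fBM_quad H F c =
       a\<^sup>2 * D t1 t0 + b\<^sup>2 * D t3 t2 + a * b * (D t3 t0 + D t2 t1 - D t3 t1 - D t2 t0)" .
    moreover have "D t1 t0 = h powr (2 * H)"
      using assms by (simp add: D_def t of_nat_diff algebra_simps)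
    moreover have "D t3 t2 = h powr (2 * H)"
      using assms by (simp add: D_def t of_nat_diff algebra_simps)
    moreover have "D t3 t0 = \<bar>real k - real j + 1\<bar> powr (2 * H) * h powr (2 * H)"
    proof -
      have "t3 - t0 = (real k - real j + 1) * h" using assms by (simp add: t of_nat_diff algebra_simps)
      then show ?thesis using h by (simp add: D_def abs_mult powr_mult)
    qed
    moreover have "D t2 t1 = \<bar>real k - real j - 1\<bar> powr (2 * H) * h powr (2 * H)"
    proof -
      have "t2 - t1 = (real k - real j - 1) * h" using assms by (simp add: t of_nat_diff algebra_simps)
      then show ?thesis using h by (simp add: D_def abs_mult powr_mult)
    qed
    moreover have "D t3 t1 = \<bar>real k - real j\<bar> powr (2 * H) * h powr (2 * H)"
    proof -
      have "t3 - t1 = (real k - real j) * h" using assms by (simp add: t algebra_simps)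
      then show ?thesis using h by (simp add: D_def abs_mult powr_mult)
    qed
    moreover have "D t2 t0 = \<bar>real k - real j\<bar> powr (2 * H) * h powr (2 * H)"
    proof -
      have "t2 - t0 = (real k - real j) * h" using assms by (simp add: t of_nat_diff algebra_simps)
      then show ?thesis using h by (simp add: D_def abs_mult powr_mult)
    qed
    ultimately show ?thesis by (simp add: fGN_cov_def field_simps)
  qed
  then show thesis using that[OF \<open>finite F\<close>] lin unfolding t by blast
qed

section \<open>Characteristic functions of finite linear combinations of the processes\<close>

context prob_space
begin

text \<open>Two cases, because \<open>gaussian_rv\<close> admits point masses: centring puts the
  mass at \<open>0\<close>, and otherwise the density reduces to the standard normal after division
  by its deviation.\<close>

lemma
  assumes X: "gaussian_rv M X" and mean: "expectation X = 0"
  shows gaussian_rv_integrable_square: "integrable M (\<lambda>x. (X x)\<^sup>2)"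
    and gaussian_rv_char: "(CLINT x|M. iexp (X x)) = complex_of_real (exp (- expectation (\<lambda>x. (X x)\<^sup>2) / 2))"
proof -
  have [measurable]: "random_variable borel X" using X by (simp add: gaussian_rv_def)
  have "integrable M (\<lambda>x. (X x)\<^sup>2) \<and>
      (CLINT x|M. iexp (X x)) = complex_of_real (exp (- expectation (\<lambda>x. (X x)\<^sup>2) / 2))"
  proof (cases "\<exists>m. AE x in M. X x = m")
    case True
    then obtain m where m: "AE x in M. X x = m" by blast
    have "expectation X = expectation (\<lambda>_. m)" using m by (intro integral_cong_AE) auto
    with mean have "m = 0" by (simp add: prob_space)
    with m have 0: "AE x in M. X x = 0" by simp
    have "(CLINT x|M. iexp (X x)) = (CLINT x|M. 1)" using 0 by (intro integral_cong_AE) auto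
    moreover have "expectation (\<lambda>x. (X x)\<^sup>2) = expectation (\<lambda>x. 0)" using 0 by (intro integral_cong_AE) auto
    moreover have "integrable M (\<lambda>x. (X x)\<^sup>2) \<longleftrightarrow> integrable M (\<lambda>x. 0 :: real)"
      using 0 by (intro integrable_cong_AE) auto
    ultimately show ?thesis by (simp add: prob_space)
  next
    case False
    then obtain m s where s: "s > 0" and D: "distributed M lborel X (normal_density m s)"
      using X by (auto simp: gaussian_rv_def)
    have m: "m = 0" using normal_distributed_expectation[OF s D] mean by simp
    have var: "expectation (\<lambda>x. (X x)\<^sup>2) = s\<^sup>2"
      using normal_distributed_variance[OF s D] mean by simp
    \<comment> \<open>The integral of a non-integrable function is \<open>0\<close> by convention,
      whereas this one is \<open>s\<^sup>2 > 0\<close>.\<close>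
    have "integrable M (\<lambda>x. (X x)\<^sup>2)"
      using not_integrable_integral_eq[of M "\<lambda>x. (X x)\<^sup>2"] var s by - (rule ccontr, simp)
    moreover have "(CLINT x|M. iexp (X x)) = complex_of_real (exp (- s\<^sup>2 / 2))"
    proof -
      have "distributed M lborel (\<lambda>x. (X x - m) / s) std_normal_density"
        using normal_standard_normal_convert[OF s, of X m] D by simp
      then have "distr M lborel (\<lambda>x. X x / s) = std_normal_distribution"
        by (simp add: distributed_def m)
      then have "char (distr M lborel (\<lambda>x. X x / s)) s = complex_of_real (exp (- s\<^sup>2 / 2))"
        by (simp add: char_std_normal_distribution)
      then show ?thesis using s by (simp add: char_def integral_distr)
    qed
    ultimately show ?thesis by (simp add: var)
  qed
  then show "integrable M (\<lambda>x. (X x)\<^sup>2)"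
    "(CLINT x|M. iexp (X x)) = complex_of_real (exp (- expectation (\<lambda>x. (X x)\<^sup>2) / 2))" by auto
qed

text \<open>The means and covariances in \<open>fractional_BM\<close> are Bochner integrals and do
  not by themselves assert integrability. Square integrability comes from the Gaussian law of each
  \<open>B t\<close>; only then can the variance of the combination be expanded into
  \<open>fBM_quad\<close>.\<close>

lemma fractional_BM_char:
  assumes B: "fractional_BM M H B" and "finite F"
  shows "(CLINT x|M. iexp (\<Sum>t\<in>F. c t * B t x)) = complex_of_real (exp (- fBM_quad H F c / 2))"
proof -
  have G: "gaussian_rv M (\<lambda>x. \<Sum>t\<in>F. c t * B t x)" if "finite F" for F c
    using B that unfolding fractional_BM_def gaussian_process_def by blast
  have [measurable]: "random_variable borel (B t)" for t
    using B unfolding fractional_BM_def gaussian_process_def by blast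
  have mean: "expectation (B t) = 0" for t using B unfolding fractional_BM_def by blast
  have cov: "expectation (\<lambda>x. B t x * B s x) = fBM_cov H t s" for t s
    using B unfolding fractional_BM_def fBM_cov_def by blast
  have sq: "integrable M (\<lambda>x. (B t x)\<^sup>2)" for t
    using gaussian_rv_integrable_square[of "B t"] G[of "{t}" "\<lambda>_. 1"] mean by simp
  have int: "integrable M (B t)" for t
    by (rule square_integrable_imp_integrable[OF _ sq]) simp
  have prod: "integrable M (\<lambda>x. B t x * B s x)" for t s
  proof (rule Bochner_Integration.integrable_bound)
    show "integrable M (\<lambda>x. (B t x)\<^sup>2 + (B s x)\<^sup>2)" using sq by simp
    have "\<bar>u * v\<bar> \<le> u\<^sup>2 + v\<^sup>2" for u v :: real
      using sum_squares_bound[of "\<bar>u\<bar>" "\<bar>v\<bar>"] mult_nonneg_nonneg[of "\<bar>u\<bar>" "\<bar>v\<bar>"]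
      unfolding abs_mult power2_abs mult.assoc by linarith
    then show "AE x in M. norm (B t x * B s x) \<le> norm ((B t x)\<^sup>2 + (B s x)\<^sup>2)" by simp
  qed simp
  have L0: "expectation (\<lambda>x. \<Sum>t\<in>F. c t * B t x) = 0"
    by (subst Bochner_Integration.integral_sum) (auto simp: int mean)
  have "expectation (\<lambda>x. (\<Sum>t\<in>F. c t * B t x)\<^sup>2) =
      expectation (\<lambda>x. \<Sum>t\<in>F. \<Sum>s\<in>F. (c t * c s) * (B t x * B s x))"
    by (simp add: power2_eq_square sum_product mult_ac)
  also have "\<dots> = (\<Sum>t\<in>F. expectation (\<lambda>x. \<Sum>s\<in>F. (c t * c s) * (B t x * B s x)))"
    by (intro Bochner_Integration.integral_sum Bochner_Integration.integrable_sum
        integrable_mult_right prod)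
  also have "\<dots> = (\<Sum>t\<in>F. \<Sum>s\<in>F. expectation (\<lambda>x. (c t * c s) * (B t x * B s x)))"
    by (intro sum.cong refl Bochner_Integration.integral_sum integrable_mult_right prod)
  also have "\<dots> = fBM_quad H F c"
    by (simp add: cov fBM_quad_def)
  finally show ?thesis using gaussian_rv_char[OF G[OF \<open>finite F\<close>] L0] by simp
qed

text \<open>The variance of \<open>\<bar>D n x\<bar>\<close> is nonnegative, so its mean is at most
  the \<open>L^2\<close> norm. Convergence of the nonnegative integrals makes them finite only
  eventually, hence the form of the first claim.\<close>

lemma
  assumes [measurable]: "\<And>n. random_variable borel (D n)"
    and lim: "(\<lambda>n. \<integral>\<^sup>+x. ennreal ((D n x)\<^sup>2) \<partial>M) \<longlonglongrightarrow> 0"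
  shows eventually_integrable_if_tendsto_L2: "\<forall>\<^sub>F n in sequentially. integrable M (D n)"
    and tendsto_L1_if_tendsto_L2: "(\<lambda>n. expectation (\<lambda>x. \<bar>D n x\<bar>)) \<longlonglongrightarrow> 0"
proof -
  let ?q = "\<lambda>n. enn2real (\<integral>\<^sup>+x. ennreal ((D n x)\<^sup>2) \<partial>M)"
  have fin: "\<forall>\<^sub>F n in sequentially. (\<integral>\<^sup>+x. ennreal ((D n x)\<^sup>2) \<partial>M) < \<infinity>"
    using lim by (rule order_tendstoD) simp
  have ev: "\<forall>\<^sub>F n in sequentially. integrable M (D n) \<and> expectation (\<lambda>x. \<bar>D n x\<bar>) \<le> sqrt (?q n)"
    using fin
  proof eventually_elim
    case (elim n)
    have sq: "integrable M (\<lambda>x. (D n x)\<^sup>2)"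
      using elim by (intro integrableI_nonneg) auto
    have int: "integrable M (D n)" by (rule square_integrable_imp_integrable[OF _ sq]) simp
    have "0 \<le> variance (\<lambda>x. \<bar>D n x\<bar>)" by (rule variance_positive)
    also have "\<dots> = expectation (\<lambda>x. (D n x)\<^sup>2) - (expectation (\<lambda>x. \<bar>D n x\<bar>))\<^sup>2"
      using int sq by (subst variance_eq) auto
    also have "expectation (\<lambda>x. (D n x)\<^sup>2) = ?q n"
      by (rule integral_eq_nn_integral) auto
    finally have "expectation (\<lambda>x. \<bar>D n x\<bar>) \<le> sqrt (?q n)"
      by (intro real_le_rsqrt) simp
    with int show ?case by simp
  qed
  then show "\<forall>\<^sub>F n in sequentially. integrable M (D n)" by eventually_elim simp
  have "?q \<longlonglongrightarrow> enn2real 0"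
    using lim by (intro tendsto_enn2real) auto
  then have lim0: "(\<lambda>n. sqrt (?q n)) \<longlonglongrightarrow> 0"
    using tendsto_real_sqrt by fastforce
  show "(\<lambda>n. expectation (\<lambda>x. \<bar>D n x\<bar>)) \<longlonglongrightarrow> 0"
  proof (rule tendsto_sandwich[OF _ _ tendsto_const lim0])
    show "\<forall>\<^sub>F n in sequentially. expectation (\<lambda>x. \<bar>D n x\<bar>) \<le> sqrt (?q n)"
      using ev by eventually_elim simp
  qed simp
qed

lemma norm_iexp_diff_le: "norm (iexp x - iexp y) \<le> \<bar>x - y\<bar>"
proof -
  have "iexp x - iexp y = iexp y * (iexp (x - y) - 1)"
    by (simp add: right_diff_distrib flip: exp_add)
  then have "norm (iexp x - iexp y) = norm (iexp (x - y) - 1)"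
    by (simp only: norm_mult norm_exp_i_times mult_1_left)
  also have "\<dots> \<le> \<bar>x - y\<bar>"
    using iexp_approx1[of "x - y" 0] by simp
  finally show ?thesis .
qed

text \<open>For partial sums, independence makes the characteristic function a product of Gaussian
  ones. Since \<open>iexp\<close> is Lipschitz, \<open>L^1\<close> convergence at the finitely many
  times in \<open>F\<close> passes it to the limit, while the exponents converge to the series. Thus
  finite linear combinations of the limit are Gaussian with the summed variance.\<close>

lemma multi_mixed_fBM_char:
  assumes MM: "multi_mixed_fBM M \<sigma> H X" and H: "\<And>k. 0 < H k" "\<And>k. H k < 1"
    and \<sigma>: "summable (\<lambda>k. (\<sigma> k)\<^sup>2)" and "finite F"
  shows "summable (\<lambda>k. (\<sigma> k)\<^sup>2 * fBM_quad (H k) F c)"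
    and "(CLINT x|M. iexp (\<Sum>t\<in>F. c t * X t x)) =
      complex_of_real (exp (- (\<Sum>k. (\<sigma> k)\<^sup>2 * fBM_quad (H k) F c) / 2))"
proof -
  \<comment> \<open>A bound for \<open>\<bar>fBM_quad (H k) F c\<bar>\<close> that does not depend
    on \<open>k\<close>, from the bound on \<open>fBM_cov\<close> uniform in the index.\<close>
  define K where "K = (\<Sum>t\<in>F. \<Sum>s\<in>F. \<bar>c t\<bar> * \<bar>c s\<bar> * (3 + t\<^sup>2 + s\<^sup>2 + (t - s)\<^sup>2))"
  have "\<bar>fBM_quad (H k) F c\<bar> \<le> K" for k
    unfolding fBM_quad_def K_def
    by (intro order_trans[OF sum_abs] sum_mono) (auto simp: abs_mult intro!: mult_left_mono abs_fBM_cov_le H)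
  then have "\<bar>(\<sigma> k)\<^sup>2 * fBM_quad (H k) F c\<bar> \<le> (\<sigma> k)\<^sup>2 * K" for k
    by (simp add: abs_mult mult_left_mono)
  then show sum: "summable (\<lambda>k. (\<sigma> k)\<^sup>2 * fBM_quad (H k) F c)"
    by (intro summable_comparison_test'[OF summable_mult2[OF \<sigma>, of K]]) auto
  obtain B where B: "\<And>k. fractional_BM M (H k) (B k)"
    and indep: "indep_vars (\<lambda>_. \<Pi>\<^sub>M t\<in>(UNIV :: real set). (borel :: real measure)) (\<lambda>k x. \<lambda>t\<in>UNIV. B k t x) UNIV"
    and X [measurable]: "\<And>t. random_variable borel (X t)"
    and L2: "\<And>t. (\<lambda>n. \<integral>\<^sup>+x. ennreal ((X t x - (\<Sum>k<n. \<sigma> k * B k t x))\<^sup>2) \<partial>M) \<longlonglongrightarrow> 0"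
    using MM unfolding multi_mixed_fBM_def by blast
  have [measurable]: "random_variable borel (B k t)" for k t
    using B[of k] unfolding fractional_BM_def gaussian_process_def by blast
  define L where "L k x = (\<Sum>t\<in>F. c t * B k t x)" for k x
  have [measurable]: "random_variable borel (L k)" for k unfolding L_def[abs_def] by measurable
  define D where "D t n x = X t x - (\<Sum>k<n. \<sigma> k * B k t x)" for t n x
  have D [measurable]: "random_variable borel (D t n)" for t n unfolding D_def[abs_def] by measurable
  have indep_L: "indep_vars (\<lambda>_. borel) (\<lambda>k x. \<sigma> k * L k x) UNIV"
  proof -
    \<comment> \<open>Each combination is a measurable functional of the whole path of its own
      component, so independence of the path-valued elements is inherited.\<close>
    have "indep_vars (\<lambda>_. borel) (\<lambda>k x. (\<lambda>f. \<sigma> k * (\<Sum>t\<in>F. c t * f t)) (\<lambda>t\<in>UNIV. B k t x)) UNIV"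
      by (rule indep_vars_compose2[OF indep]) measurable
    then show ?thesis by (simp add: L_def)
  qed
  have char_n: "(CLINT x|M. iexp (\<Sum>k<n. \<sigma> k * L k x)) =
      complex_of_real (exp (- (\<Sum>k<n. (\<sigma> k)\<^sup>2 * fBM_quad (H k) F c) / 2))" for n
  proof -
    have one: "char (distr M borel (\<lambda>x. \<sigma> k * L k x)) 1 =
        complex_of_real (exp (- ((\<sigma> k)\<^sup>2 * fBM_quad (H k) F c) / 2))" for k
    proof -
      have "char (distr M borel (\<lambda>x. \<sigma> k * L k x)) 1 = (CLINT x|M. iexp (\<Sum>t\<in>F. (\<sigma> k * c t) * B k t x))"
        by (simp add: char_def integral_distr L_def sum_distrib_left mult.assoc)
      also have "\<dots> = complex_of_real (exp (- fBM_quad (H k) F (\<lambda>t. \<sigma> k * c t) / 2))"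
        by (rule fractional_BM_char[OF B \<open>finite F\<close>])
      also have "fBM_quad (H k) F (\<lambda>t. \<sigma> k * c t) = (\<sigma> k)\<^sup>2 * fBM_quad (H k) F c"
        by (simp add: fBM_quad_def sum_distrib_left power2_eq_square mult_ac)
      finally show ?thesis .
    qed
    have "(CLINT x|M. iexp (\<Sum>k<n. \<sigma> k * L k x)) = char (distr M borel (\<lambda>x. \<Sum>k<n. \<sigma> k * L k x)) 1"
      by (simp add: char_def integral_distr)
    also have "\<dots> = (\<Prod>k<n. char (distr M borel (\<lambda>x. \<sigma> k * L k x)) 1)"
      by (rule char_distr_sum[OF indep_vars_subset[OF indep_L]]) simp
    also have "\<dots> = complex_of_real (exp (- (\<Sum>k<n. (\<sigma> k)\<^sup>2 * fBM_quad (H k) F c) / 2))"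
      unfolding one
      by (simp add: exp_sum[symmetric] sum_negf[symmetric] sum_divide_distrib flip: of_real_prod)
    finally show ?thesis .
  qed
  let ?I = "\<lambda>n. CLINT x|M. iexp (\<Sum>k<n. \<sigma> k * L k x)"
  have lim1: "?I \<longlonglongrightarrow> complex_of_real (exp (- (\<Sum>k. (\<sigma> k)\<^sup>2 * fBM_quad (H k) F c) / 2))"
    unfolding char_n by (intro tendsto_intros summable_LIMSEQ sum) auto
  have "\<forall>\<^sub>F n in sequentially. \<forall>t\<in>F. integrable M (D t n)"
    using eventually_integrable_if_tendsto_L2[OF D L2[folded D_def]] \<open>finite F\<close>
    by (intro eventually_ball_finite) auto
  then have "\<forall>\<^sub>F n in sequentially. norm ((CLINT x|M. iexp (\<Sum>t\<in>F. c t * X t x)) - ?I n) \<le>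
      (\<Sum>t\<in>F. \<bar>c t\<bar> * expectation (\<lambda>x. \<bar>D t n x\<bar>))"
  proof eventually_elim
    case (elim n)
    have i: "integrable M (\<lambda>x. iexp (\<Sum>t\<in>F. c t * X t x))" "integrable M (\<lambda>x. iexp (\<Sum>k<n. \<sigma> k * L k x))"
      by (intro integrable_const_bound[of _ 1]; simp)+
    have le: "norm (iexp (\<Sum>t\<in>F. c t * X t x) - iexp (\<Sum>k<n. \<sigma> k * L k x)) \<le> (\<Sum>t\<in>F. \<bar>c t\<bar> * \<bar>D t n x\<bar>)" for x
    proof -
      have "(\<Sum>k<n. \<sigma> k * L k x) = (\<Sum>t\<in>F. c t * (\<Sum>k<n. \<sigma> k * B k t x))"
        by (simp add: L_def sum_distrib_left mult_ac sum.swap[of _ F])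
      then have "(\<Sum>t\<in>F. c t * X t x) - (\<Sum>k<n. \<sigma> k * L k x) = (\<Sum>t\<in>F. c t * D t n x)"
        by (simp add: D_def right_diff_distrib sum_subtractf)
      then have "\<bar>(\<Sum>t\<in>F. c t * X t x) - (\<Sum>k<n. \<sigma> k * L k x)\<bar> \<le> (\<Sum>t\<in>F. \<bar>c t\<bar> * \<bar>D t n x\<bar>)"
        using sum_abs[of "\<lambda>t. c t * D t n x" F] by (simp add: abs_mult)
      then show ?thesis by (rule order_trans[OF norm_iexp_diff_le])
    qed
    have "norm ((CLINT x|M. iexp (\<Sum>t\<in>F. c t * X t x)) - ?I n) =
        norm (CLINT x|M. iexp (\<Sum>t\<in>F. c t * X t x) - iexp (\<Sum>k<n. \<sigma> k * L k x))"
      by (subst Bochner_Integration.integral_diff[OF i]) simp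
    also have "\<dots> \<le> expectation (\<lambda>x. norm (iexp (\<Sum>t\<in>F. c t * X t x) - iexp (\<Sum>k<n. \<sigma> k * L k x)))"
      by (rule integral_norm_bound)
    also have "\<dots> \<le> expectation (\<lambda>x. \<Sum>t\<in>F. \<bar>c t\<bar> * \<bar>D t n x\<bar>)"
      using i elim le by (intro integral_mono integrable_norm Bochner_Integration.integrable_diff
        Bochner_Integration.integrable_sum integrable_mult_right integrable_abs) auto
    also have "\<dots> = (\<Sum>t\<in>F. \<bar>c t\<bar> * expectation (\<lambda>x. \<bar>D t n x\<bar>))"
      using elim by (subst Bochner_Integration.integral_sum) auto
    finally show ?case .
  qed
  moreover have "(\<lambda>n. \<Sum>t\<in>F. \<bar>c t\<bar> * expectation (\<lambda>x. \<bar>D t n x\<bar>)) \<longlonglongrightarrow> (\<Sum>t\<in>F. \<bar>c t\<bar> * 0)"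
    by (intro tendsto_intros tendsto_L1_if_tendsto_L2 D L2[folded D_def])
  then have "(\<lambda>n. \<Sum>t\<in>F. \<bar>c t\<bar> * expectation (\<lambda>x. \<bar>D t n x\<bar>)) \<longlonglongrightarrow> 0" by simp
  ultimately have "(\<lambda>n. (CLINT x|M. iexp (\<Sum>t\<in>F. c t * X t x)) - ?I n) \<longlonglongrightarrow> 0"
    by (rule Lim_null_comparison)
  then have "(\<lambda>n. (CLINT x|M. iexp (\<Sum>t\<in>F. c t * X t x)) - ((CLINT x|M. iexp (\<Sum>t\<in>F. c t * X t x)) - ?I n))
      \<longlonglongrightarrow> (CLINT x|M. iexp (\<Sum>t\<in>F. c t * X t x)) - 0"
    by (intro tendsto_intros)
  then have "?I \<longlonglongrightarrow> (CLINT x|M. iexp (\<Sum>t\<in>F. c t * X t x))" by simp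
  then show "(CLINT x|M. iexp (\<Sum>t\<in>F. c t * X t x)) =
      complex_of_real (exp (- (\<Sum>k. (\<sigma> k)\<^sup>2 * fBM_quad (H k) F c) / 2))"
    using lim1 by (rule LIMSEQ_unique)
qed

end

section \<open>Increments of the multi-mixed fractional Brownian motion\<close>

text \<open>A crude bound valid at every lag, including those \<open>d \<le> 1\<close> where the
  decay estimate does not apply; it serves for summability over the components.\<close>

lemma abs_fGN_cov_le_poly:
  assumes "0 < H" "H < 1"
  shows "\<bar>fGN_cov H d\<bar> \<le> 3 + (d + 1)\<^sup>2 + (d - 1)\<^sup>2 + d\<^sup>2"
proof -
  have "\<bar>(a + b - 2 * c) / 2\<bar> \<le> a + b + c" if "0 \<le> a" "0 \<le> b" "0 \<le> c" for a b c :: real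
    using that by (simp add: abs_le_iff)
  then have "\<bar>fGN_cov H d\<bar> \<le> \<bar>d + 1\<bar> powr (2 * H) + \<bar>d - 1\<bar> powr (2 * H) + \<bar>d\<bar> powr (2 * H)"
    unfolding fGN_cov_def by simp
  also have "\<dots> \<le> (1 + (d + 1)\<^sup>2) + (1 + (d - 1)\<^sup>2) + (1 + d\<^sup>2)"
    by (intro add_mono abs_powr_le_one_plus_square assms)
  finally show ?thesis by simp
qed

definition mmfBM_var :: "(nat \<Rightarrow> real) \<Rightarrow> (nat \<Rightarrow> real) \<Rightarrow> real \<Rightarrow> real" where
  "mmfBM_var \<sigma> H h = (\<Sum>k. (\<sigma> k)\<^sup>2 * \<bar>h\<bar> powr (2 * H k))"

definition mmfBM_incr_corr :: "(nat \<Rightarrow> real) \<Rightarrow> (nat \<Rightarrow> real) \<Rightarrow> real \<Rightarrow> real \<Rightarrow> real" where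
  "mmfBM_incr_corr \<sigma> H h d =
     (\<Sum>k. (\<sigma> k)\<^sup>2 * \<bar>h\<bar> powr (2 * H k) * fGN_cov (H k) d) / mmfBM_var \<sigma> H h"

text \<open>\<open>H_sup\<close> keeps all indices away from \<open>1\<close> at once, so that
  \<open>2 * H_sup - 2 < 0\<close> is a common decay exponent for the correlations.\<close>

locale mmfBM_params =
  fixes \<sigma> H :: "nat \<Rightarrow> real" and H_sup :: real
  assumes \<sigma>_pos: "\<sigma> k > 0" and \<sigma>_summable: "summable (\<lambda>k. (\<sigma> k)\<^sup>2)"
    and H_pos: "0 < H k" and H_le_sup: "H k \<le> H_sup" and H_sup_less: "H_sup < 1"
begin

lemma H_less: "H k < 1"
  using H_le_sup[of k] H_sup_less by simp

lemma var_summable: "summable (\<lambda>k. (\<sigma> k)\<^sup>2 * \<bar>h\<bar> powr (2 * H k))"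
  by (rule summable_comparison_test'[OF summable_mult2[OF \<sigma>_summable, of "1 + h\<^sup>2"]])
    (auto intro!: mult_left_mono abs_powr_le_one_plus_square H_pos H_less)

lemma term_le_var: "(\<sigma> k)\<^sup>2 * \<bar>h\<bar> powr (2 * H k) \<le> mmfBM_var \<sigma> H h"
  unfolding mmfBM_var_def using sum_le_suminf[OF var_summable, of "{k}" h] by simp

lemma var_pos: "h \<noteq> 0 \<Longrightarrow> mmfBM_var \<sigma> H h > 0"
  using \<sigma>_pos[of 0] by (intro less_le_trans[OF _ term_le_var[of 0 h]] mult_pos_pos) auto

lemma var_le: "mmfBM_var \<sigma> H h \<le> (1 + h\<^sup>2) * (\<Sum>k. (\<sigma> k)\<^sup>2)"
  unfolding mmfBM_var_def mult.commute[of "1 + h\<^sup>2"] suminf_mult2[OF \<sigma>_summable]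
  by (intro suminf_le var_summable summable_mult2 \<sigma>_summable mult_left_mono
      abs_powr_le_one_plus_square H_pos H_less) simp

lemma cov_summable: "summable (\<lambda>k. (\<sigma> k)\<^sup>2 * \<bar>h\<bar> powr (2 * H k) * fGN_cov (H k) d)"
proof (rule summable_comparison_test')
  let ?K = "3 + (d + 1)\<^sup>2 + (d - 1)\<^sup>2 + d\<^sup>2"
  show "summable (\<lambda>k. (\<sigma> k)\<^sup>2 * \<bar>h\<bar> powr (2 * H k) * ?K)"
    by (intro summable_mult2 var_summable)
  show "norm ((\<sigma> k)\<^sup>2 * \<bar>h\<bar> powr (2 * H k) * fGN_cov (H k) d) \<le> (\<sigma> k)\<^sup>2 * \<bar>h\<bar> powr (2 * H k) * ?K" for k
    unfolding real_norm_def abs_mult[of _ "fGN_cov (H k) d"]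
    by (intro mult_mono abs_fGN_cov_le_poly H_pos H_less) auto
qed

lemma abs_incr_corr_le:
  assumes "h \<noteq> 0" and "d \<ge> 2"
  shows "\<bar>mmfBM_incr_corr \<sigma> H h d\<bar> \<le> 2 * (d - 1) powr (2 * H_sup - 2)"
proof -
  let ?a = "\<lambda>k. (\<sigma> k)\<^sup>2 * \<bar>h\<bar> powr (2 * H k)" and ?B = "2 * (d - 1) powr (2 * H_sup - 2)"
  have B: "\<bar>fGN_cov (H k) d\<bar> \<le> ?B" for k
  proof -
    have "\<bar>fGN_cov (H k) d\<bar> \<le> 2 * (d - 1) powr (2 * H k - 2)"
      using \<open>d \<ge> 2\<close> by (intro abs_fGN_cov_le H_pos H_less) auto
    \<comment> \<open>Here \<open>d - 1 \<ge> 1\<close>, so enlarging the exponent enlarges the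
      power; this is where \<open>d \<ge> 2\<close> enters.\<close>
    also have "\<dots> \<le> ?B"
      using \<open>d \<ge> 2\<close> H_le_sup[of k] by (intro mult_left_mono powr_mono) auto
    finally show ?thesis .
  qed
  have le: "norm (?a k * fGN_cov (H k) d) \<le> ?a k * ?B" for k
    unfolding real_norm_def abs_mult[of _ "fGN_cov (H k) d"] by (intro mult_mono B) auto
  have "\<bar>\<Sum>k. ?a k * fGN_cov (H k) d\<bar> \<le> (\<Sum>k. ?a k * ?B)"
    using norm_suminf_le[OF le summable_mult2[OF var_summable]] by simp
  also have "\<dots> = mmfBM_var \<sigma> H h * ?B"
    unfolding mmfBM_var_def by (rule suminf_mult2[OF var_summable, symmetric])
  finally show ?thesis
    using var_pos[OF \<open>h \<noteq> 0\<close>] by (simp add: mmfBM_incr_corr_def field_simps abs_divide)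
qed

end

section \<open>Law of large numbers for the standardised increments, and moment growth\<close>

locale mmfBM = prob_space M + mmfBM_params \<sigma> H H_sup
  for M :: "'a measure" and \<sigma> H H_sup +
  fixes X :: "real \<Rightarrow> 'a \<Rightarrow> real"
  assumes mmfBM: "multi_mixed_fBM M \<sigma> H X"
begin

lemma X_measurable [measurable]: "X t \<in> borel_measurable M"
  using mmfBM unfolding multi_mixed_fBM_def by blast

lemma X_continuous: "x \<in> space M \<Longrightarrow> continuous_on UNIV (\<lambda>t. X t x)"
  using mmfBM unfolding multi_mixed_fBM_def continuous_paths_def by blast

definition std_incr :: "real \<Rightarrow> nat \<Rightarrow> 'a \<Rightarrow> real" where
  "std_incr h k x = (X (real k * h) x - X (real (k - 1) * h) x) / sqrt (mmfBM_var \<sigma> H h)"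

lemma std_incr_measurable [measurable]: "std_incr h k \<in> borel_measurable M"
  unfolding std_incr_def[abs_def] by measurable

text \<open>The variance of the combination is affine in the fractional noise covariances, so
  summation over components yields \<open>V h\<close> times a form with the averaged correlation.
  The case \<open>j = k\<close> is included: the correlation at lag \<open>0\<close> is
  \<open>1\<close>.\<close>

lemma std_gaussian_pair_std_incr:
  assumes "h > 0" "1 \<le> j" "j \<le> k"
  shows "std_gaussian_pair M (mmfBM_incr_corr \<sigma> H h (real k - real j)) (std_incr h j) (std_incr h k)"
  unfolding std_gaussian_pair_def
proof (intro conjI allI)
  fix a b
  let ?V = "mmfBM_var \<sigma> H h" and ?d = "real k - real j"
  have V: "?V > 0" using var_pos assms(1) by simp
  obtain F c where F: "finite F"
    "\<And>g. (\<Sum>t\<in>F. c t * g t) = (a / sqrt ?V) * (g (real j * h) - g (real (j - 1) * h)) +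
       (b / sqrt ?V) * (g (real k * h) - g (real (k - 1) * h))"
    "\<And>H. 0 < H \<Longrightarrow> fBM_quad H F c = h powr (2 * H) * ((a / sqrt ?V)\<^sup>2 +
       2 * fGN_cov H (real k - real j) * (a / sqrt ?V) * (b / sqrt ?V) + (b / sqrt ?V)\<^sup>2)"
    using fBM_quad_increments[OF assms, of "a / sqrt ?V" "b / sqrt ?V"] by blast
  have lin: "a * std_incr h j x + b * std_incr h k x = (\<Sum>t\<in>F. c t * X t x)" for x
    unfolding F(2) by (simp add: std_incr_def)
  let ?v = "\<lambda>i. (\<sigma> i)\<^sup>2 * \<bar>h\<bar> powr (2 * H i)"
  have "(\<sigma> i)\<^sup>2 * fBM_quad (H i) F c =
      (a\<^sup>2 + b\<^sup>2) / ?V * ?v i + 2 * a * b / ?V * (?v i * fGN_cov (H i) ?d)" for i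
    using V \<open>h > 0\<close> unfolding F(3)[OF H_pos]
    by (simp add: power_divide) (simp add: field_simps)
  then have "(\<Sum>i. (\<sigma> i)\<^sup>2 * fBM_quad (H i) F c) =
      (\<Sum>i. (a\<^sup>2 + b\<^sup>2) / ?V * ?v i + 2 * a * b / ?V * (?v i * fGN_cov (H i) ?d))" by simp
  also have "\<dots> = (a\<^sup>2 + b\<^sup>2) / ?V * (\<Sum>i. ?v i) + 2 * a * b / ?V * (\<Sum>i. ?v i * fGN_cov (H i) ?d)"
    by (subst suminf_add[symmetric]) (intro summable_mult var_summable cov_summable,
      intro summable_mult var_summable cov_summable, simp only: suminf_mult[OF var_summable] suminf_mult[OF cov_summable])
  also have "\<dots> = a\<^sup>2 + 2 * mmfBM_incr_corr \<sigma> H h ?d * a * b + b\<^sup>2"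
    using V unfolding mmfBM_var_def[symmetric]
    by (simp add: mmfBM_incr_corr_def field_simps)
  finally have "(\<Sum>i. (\<sigma> i)\<^sup>2 * fBM_quad (H i) F c) = a\<^sup>2 + 2 * mmfBM_incr_corr \<sigma> H h ?d * a * b + b\<^sup>2" .
  then show "(CLINT x|M. iexp (a * std_incr h j x + b * std_incr h k x)) =
      complex_of_real (exp (- (a\<^sup>2 + 2 * mmfBM_incr_corr \<sigma> H h ?d * a * b + b\<^sup>2) / 2))"
    unfolding lin using multi_mixed_fBM_char(2)[OF mmfBM H_pos H_less \<sigma>_summable F(1), of c] by (simp only:)
qed measurable

lemma std_incr_mean_abs_powr:
  assumes "p > 0" and "T > 0"
  shows "tendsto_in_prob M (\<lambda>n x. (\<Sum>k=1..n. \<bar>std_incr (T / real n) k x\<bar> powr p) / real n)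
    (ereal (gaussian_abs_moment p))"
proof (rule std_gaussian_array_mean_abs_powr[OF \<open>p > 0\<close>])
  show "std_gaussian_pair M (mmfBM_incr_corr \<sigma> H (T / real n) (real k - real j))
      (std_incr (T / real n) j) (std_incr (T / real n) k)" if "1 \<le> j" "j \<le> k" "k \<le> n" for n j k
    using that \<open>T > 0\<close> by (intro std_gaussian_pair_std_incr) auto
  fix \<delta> :: real assume "\<delta> > 0"
  have lim: "((\<lambda>d. 2 * (d - 1) powr (2 * H_sup - 2)) \<longlongrightarrow> 2 * 0) at_top"
    using H_sup_less
    by (intro tendsto_intros tendsto_neg_powr filterlim_tendsto_add_at_top[OF tendsto_const[of "-1"] filterlim_ident, simplified]) auto
  then have "\<forall>\<^sub>F d in at_top. 2 * (d - 1) powr (2 * H_sup - 2) < \<delta>"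
    using \<open>\<delta> > 0\<close> by (intro order_tendstoD) auto
  then obtain D where D: "\<And>d. d \<ge> D \<Longrightarrow> 2 * (d - 1) powr (2 * H_sup - 2) < \<delta>"
    by (auto simp: eventually_at_top_linorder)
  \<comment> \<open>The correlation bound contains neither the step size nor \<open>n\<close>, so
    this \<open>J\<close> serves all rows; \<open>2\<close> is the least lag for which the bound is
    available.\<close>
  define J where "J = nat \<lceil>max D 2\<rceil>"
  have J: "real J \<ge> D" "real J \<ge> 2" unfolding J_def by linarith+
  show "\<exists>J. \<forall>n j k. 1 \<le> j \<longrightarrow> j + J \<le> k \<longrightarrow> k \<le> n \<longrightarrow> \<bar>mmfBM_incr_corr \<sigma> H (T / real n) (real k - real j)\<bar> < \<delta>"
  proof (intro exI allI impI)
    fix n j k assume *: "1 \<le> j" "j + J \<le> k" "k \<le> n"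
    then have "real J \<le> real k - real j" by linarith
    with J have d: "D \<le> real k - real j" "2 \<le> real k - real j" by auto
    show "\<bar>mmfBM_incr_corr \<sigma> H (T / real n) (real k - real j)\<bar> < \<delta>"
      using * \<open>T > 0\<close> d by (intro le_less_trans[OF abs_incr_corr_le D]) auto
  qed
qed measurable

text \<open>The variance is at most a multiple of \<open>1 + t\<^sup>2\<close>, hence linear growth
  of the first moment, which the exponential kernel of the drift absorbs. Time \<open>0\<close> is
  excluded because the proof divides by the standard deviation.\<close>

lemma expectation_abs_le:
  assumes "t \<noteq> 0"
  shows "integrable M (X t)"
    and "expectation (\<lambda>x. \<bar>X t x\<bar>) \<le> gaussian_abs_moment 1 * sqrt (\<Sum>k. (\<sigma> k)\<^sup>2) * (1 + \<bar>t\<bar>)"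
proof -
  let ?V = "mmfBM_var \<sigma> H t" and ?S = "\<Sum>k. (\<sigma> k)\<^sup>2"
  have V: "?V > 0" using var_pos assms by simp
  define Z where "Z x = X t x / sqrt ?V" for x
  have XZ: "X t x = sqrt ?V * Z x" for x using V by (simp add: Z_def)
  \<comment> \<open>Paired with itself, a standard normal variable has correlation \<open>1\<close>,
    since \<open>a\<^sup>2 + 2 * a * b + b\<^sup>2 = (a + b)\<^sup>2\<close>; this makes the moment
    facts for pairs applicable.\<close>
  have Z: "std_gaussian_pair M 1 Z Z"
    unfolding std_gaussian_pair_def
  proof (intro conjI allI)
    fix a b :: real
    have "fBM_quad (H k) {t} (\<lambda>_. (a + b) / sqrt ?V) = (a + b)\<^sup>2 / ?V * \<bar>t\<bar> powr (2 * H k)" for k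
      using V by (simp add: fBM_quad_def fBM_cov_def power2_eq_square)
    then have "(\<sigma> k)\<^sup>2 * fBM_quad (H k) {t} (\<lambda>_. (a + b) / sqrt ?V) =
        (a + b)\<^sup>2 / ?V * ((\<sigma> k)\<^sup>2 * \<bar>t\<bar> powr (2 * H k))" for k by simp
    then have "(\<Sum>k. (\<sigma> k)\<^sup>2 * fBM_quad (H k) {t} (\<lambda>_. (a + b) / sqrt ?V)) = (a + b)\<^sup>2 / ?V * ?V"
      unfolding mmfBM_var_def suminf_mult[OF var_summable, symmetric] by (simp only: mmfBM_var_def)
    also have "\<dots> = a\<^sup>2 + 2 * 1 * a * b + b\<^sup>2" using V by (simp add: power2_sum)
    finally show "(CLINT x|M. iexp (a * Z x + b * Z x)) = complex_of_real (exp (- (a\<^sup>2 + 2 * 1 * a * b + b\<^sup>2) / 2))"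
      using multi_mixed_fBM_char(2)[OF mmfBM H_pos H_less \<sigma>_summable, of "{t}" "\<lambda>_. (a + b) / sqrt ?V"]
      by (simp add: Z_def distrib_right add_divide_distrib)
  qed (simp_all add: Z_def[abs_def])
  have [measurable]: "random_variable borel Z" unfolding Z_def[abs_def] by measurable
  have i: "integrable M (\<lambda>x. \<bar>Z x\<bar>)" and e: "expectation (\<lambda>x. \<bar>Z x\<bar>) = gaussian_abs_moment 1"
    using std_gaussian_pair_integrable[OF Z, of 1] std_gaussian_pair_expectation[OF Z, of 1] by auto
  show "integrable M (X t)"
    unfolding XZ[abs_def] using i by (intro integrable_mult_right) (simp add: integrable_abs_iff)
  have "expectation (\<lambda>x. \<bar>X t x\<bar>) = sqrt ?V * gaussian_abs_moment 1"
    using V by (simp add: XZ abs_mult e)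
  also have "sqrt ?V \<le> sqrt (?S * (1 + \<bar>t\<bar>)\<^sup>2)"
  proof (rule real_sqrt_le_mono)
    have "?V \<le> (1 + t\<^sup>2) * ?S" by (rule var_le)
    also have "\<dots> \<le> (1 + \<bar>t\<bar>)\<^sup>2 * ?S"
      by (intro mult_right_mono suminf_nonneg \<sigma>_summable) (auto simp: power2_sum)
    finally show "?V \<le> ?S * (1 + \<bar>t\<bar>)\<^sup>2" by (simp add: mult.commute)
  qed
  also have "sqrt (?S * (1 + \<bar>t\<bar>)\<^sup>2) = sqrt ?S * (1 + \<bar>t\<bar>)"
    by (simp add: real_sqrt_mult)
  finally show "expectation (\<lambda>x. \<bar>X t x\<bar>) \<le> gaussian_abs_moment 1 * sqrt ?S * (1 + \<bar>t\<bar>)"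
    using gaussian_abs_moment_pos[of 1] by (simp add: mult_ac)
qed

end

section \<open>The drift of the Ornstein--Uhlenbeck process\<close>

text \<open>With \<open>u = T - s\<close>, half of the decay \<open>exp (- lam * u)\<close> absorbs
  the linear factor, and the other half is an exponential density of rate \<open>lam / 2\<close> up
  to a constant. In \<open>C\<close>, the factor \<open>1 + \<bar>T\<bar> + 2 / lam\<close> comes
  from the former and the last \<open>2 / lam\<close> from normalising the latter.\<close>

lemma nn_integral_exp_times_linear_finite:
  assumes "lam > 0" and "K \<ge> 0"
  shows "(\<integral>\<^sup>+s. ennreal (indicator {..T} s * (exp (lam * s) * (K * (1 + \<bar>s\<bar>)))) \<partial>lborel) < \<infinity>"
proof -
  let ?f = "exponential_density (lam / 2)"
  define C where "C = K * (1 + \<bar>T\<bar> + 2 / lam) * exp (lam * T) * (2 / lam)"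
  have C: "C \<ge> 0" using assms by (simp add: C_def)
  have le: "indicator {..T} s * (exp (lam * s) * (K * (1 + \<bar>s\<bar>))) \<le> C * ?f (T - s)" for s
  proof (cases "s \<le> T")
    case True
    define u where "u = T - s"
    have u: "u \<ge> 0" "s = T - u" using True by (auto simp: u_def)
    have "lam * u / 2 \<le> exp (lam * u / 2)" using exp_ge_add_one_self[of "lam * u / 2"] by linarith
    then have "u \<le> 2 / lam * exp (lam * u / 2)" using \<open>lam > 0\<close> by (simp add: field_simps)
    moreover have "1 + \<bar>T\<bar> \<le> (1 + \<bar>T\<bar>) * exp (lam * u / 2)"
      using u(1) \<open>lam > 0\<close> mult_left_mono[of 1 "exp (lam * u / 2)" "1 + \<bar>T\<bar>"] by simp
    moreover have "1 + \<bar>s\<bar> \<le> 1 + \<bar>T\<bar> + u" using u by linarith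
    ultimately have "1 + \<bar>s\<bar> \<le> (1 + \<bar>T\<bar> + 2 / lam) * exp (lam * u / 2)"
      by (simp add: distrib_right)
    moreover have E: "exp (lam * s) = exp (lam * T) * exp (- lam * u / 2) * exp (- lam * u / 2)"
      by (simp add: u(2) algebra_simps flip: exp_add)
    ultimately have "exp (lam * s) * (K * (1 + \<bar>s\<bar>)) \<le> exp (lam * s) * (K * ((1 + \<bar>T\<bar> + 2 / lam) * exp (lam * u / 2)))"
      using \<open>K \<ge> 0\<close> by (intro mult_left_mono) auto
    also have "\<dots> = K * (1 + \<bar>T\<bar> + 2 / lam) * exp (lam * T) * exp (- lam * u / 2) *
        (exp (- lam * u / 2) * exp (lam * u / 2))"
      unfolding E by (simp only: mult_ac)
    also have "exp (- lam * u / 2) * exp (lam * u / 2) = 1" by (simp flip: exp_add)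
    also have "K * (1 + \<bar>T\<bar> + 2 / lam) * exp (lam * T) * exp (- lam * u / 2) * 1 = C * ?f u"
      using u(1) \<open>lam > 0\<close> by (simp add: C_def exponential_density_def mult_ac)
    finally show ?thesis using True by (simp add: u_def)
  next
    case False
    then show ?thesis using C assms by (simp add: exponential_density_nonneg)
  qed
  have "(\<integral>\<^sup>+s. ennreal (?f s) \<partial>lborel) = 1"
    using prob_space.emeasure_space_1[OF prob_space_exponential_density[of "lam / 2"]] \<open>lam > 0\<close>
    by (simp add: emeasure_density)
  then have 1: "(\<integral>\<^sup>+s. ennreal (?f (T - s)) \<partial>lborel) = 1"
    using nn_integral_real_affine[of "\<lambda>s. ennreal (?f s)" "-1" T] by simp
  have "(\<integral>\<^sup>+s. ennreal (indicator {..T} s * (exp (lam * s) * (K * (1 + \<bar>s\<bar>)))) \<partial>lborel) \<le>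
      (\<integral>\<^sup>+s. ennreal C * ennreal (?f (T - s)) \<partial>lborel)"
    using C le by (intro nn_integral_mono) (simp flip: ennreal_mult' add: ennreal_leI)
  also have "\<dots> = ennreal C" by (subst nn_integral_cmult) (auto simp: 1)
  also have "\<dots> < \<infinity>" by simp
  finally show ?thesis .
qed

text \<open>Pulling out \<open>exp (- lam * t)\<close> leaves the product of a factor that is
  Lipschitz on nonnegative times and an indefinite integral \<open>J\<close>. \<open>J\<close> is
  bounded by integrability on the half-line and Lipschitz on \<open>{0..T}\<close> because its
  integrand is continuous, hence bounded, there.\<close>

lemma set_integrable_exp_integral_Lipschitz:
  fixes g :: "real \<Rightarrow> real"
  assumes lam: "lam > 0" and int: "set_integrable lborel {..T} (\<lambda>s. exp (lam * s) * g s)"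
    and cont: "continuous_on {0..T} g"
  obtains C where "C \<ge> 0" "\<And>s t. \<lbrakk>0 \<le> s; s \<le> t; t \<le> T\<rbrakk> \<Longrightarrow>
    \<bar>(LINT r:{..t}|lborel. exp (- lam * (t - r)) * g r) - (LINT r:{..s}|lborel. exp (- lam * (s - r)) * g r)\<bar>
      \<le> C * (t - s)"
proof -
  define f where "f r = exp (lam * r) * g r" for r
  define J where "J t = (LINT r:{..t}|lborel. f r)" for t
  define K where "K = (LINT r:{..T}|lborel. \<bar>f r\<bar>)"
  have "compact (f ` {0..T})"
    unfolding f_def by (intro compact_continuous_image continuous_intros cont) auto
  then obtain B where B: "B > 0" "\<And>r. r \<in> {0..T} \<Longrightarrow> \<bar>f r\<bar> \<le> B"
    using compact_imp_bounded[THEN bounded_pos[THEN iffD1]] by (metis image_eqI real_norm_def)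
  have int_f: "set_integrable lborel A f" if "A \<subseteq> {..T}" "A \<in> sets lborel" for A
    using set_integrable_subset[OF int[folded f_def] that(2,1)] by (simp add: f_def[abs_def])
  have K: "K \<ge> 0" unfolding K_def set_lebesgue_integral_def by (intro integral_nonneg_AE) auto
  have J_le: "\<bar>J t\<bar> \<le> K" if "t \<le> T" for t
  proof -
    have "\<bar>J t\<bar> \<le> (LINT r:{..t}|lborel. \<bar>f r\<bar>)"
      unfolding J_def using that by (intro set_integral_norm_bound[of lborel _ f, unfolded real_norm_def] int_f) auto
    also have "\<dots> \<le> K"
      unfolding K_def set_lebesgue_integral_def
      using set_integrable_abs[OF int_f[of "{..t}"]] set_integrable_abs[OF int_f[of "{..T}"]] that
      by (intro integral_mono) (auto simp: set_integrable_def indicator_def)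
    finally show ?thesis .
  qed
  have J_diff: "\<bar>J t - J s\<bar> \<le> B * (t - s)" if "0 \<le> s" "s \<le> t" "t \<le> T" for s t
  proof -
    have "{..t} = {..s} \<union> {s<..t}" using that by auto
    then have "J t = J s + (LINT r:{s<..t}|lborel. f r)"
      unfolding J_def using that by (simp only:) (intro set_integral_Un int_f; auto)
    then have "\<bar>J t - J s\<bar> = \<bar>LINT r:{s<..t}|lborel. f r\<bar>" by simp
    also have "\<dots> \<le> (LINT r:{s<..t}|lborel. \<bar>f r\<bar>)"
      using that by (intro set_integral_norm_bound[of lborel _ f, unfolded real_norm_def] int_f) auto
    also have "\<dots> \<le> (LINT r:{s<..t}|lborel. B)"
      using that B by (intro set_integral_mono set_integrable_abs int_f) (auto simp: set_integrable_def)
    also have "\<dots> = B * (t - s)"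
      using that by (simp add: set_lebesgue_integral_def)
    finally show ?thesis .
  qed
  have eq: "(LINT r:{..t}|lborel. exp (- lam * (t - r)) * g r) = exp (- lam * t) * J t" for t
    unfolding J_def f_def
    by (subst set_integral_mult_right[symmetric]) (simp add: algebra_simps mult_exp_exp)
  have exp_diff: "\<bar>exp (- lam * t) - exp (- lam * s)\<bar> \<le> lam * (t - s)" if "0 \<le> s" "s \<le> t" for s t
  proof -
    have "exp (- lam * s) - exp (- lam * t) = exp (- lam * s) * (1 - exp (- (lam * (t - s))))"
      by (simp add: right_diff_distrib algebra_simps mult_exp_exp)
    also have "\<dots> \<le> 1 * (lam * (t - s))"
      using that lam exp_ge_add_one_self[of "- (lam * (t - s))"] by (intro mult_mono) auto
    finally show ?thesis using that lam by simp
  qed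
  show thesis
  proof (rule that[of "lam * K + B"])
    show "0 \<le> lam * K + B" using lam K B by simp
    fix s t assume st: "0 \<le> s" "s \<le> t" "t \<le> T"
    have "exp (- lam * t) * J t - exp (- lam * s) * J s =
        (exp (- lam * t) - exp (- lam * s)) * J t + exp (- lam * s) * (J t - J s)"
      by (simp add: algebra_simps)
    also have "\<bar>\<dots>\<bar> \<le> \<bar>exp (- lam * t) - exp (- lam * s)\<bar> * \<bar>J t\<bar> + exp (- lam * s) * \<bar>J t - J s\<bar>"
      by (rule order_trans[OF abs_triangle_ineq]) (simp add: abs_mult)
    also have "\<dots> \<le> (lam * (t - s)) * K + 1 * (B * (t - s))"
      using st lam B by (intro add_mono mult_mono exp_diff J_le J_diff) auto
    also have "\<dots> = (lam * K + B) * (t - s)" by (simp add: algebra_simps)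
    finally show "\<bar>(LINT r:{..t}|lborel. exp (- lam * (t - r)) * g r) -
        (LINT r:{..s}|lborel. exp (- lam * (s - r)) * g r)\<bar> \<le> (lam * K + B) * (t - s)"
      unfolding eq .
  qed
qed

section \<open>Pathwise existence, regularity and negligibility of the drift\<close>

context mmfBM
begin

text \<open>By path continuity the process is the pointwise limit of its values at times rounded
  down to multiples of \<open>1 / Suc n\<close>, and only countably many such times occur. Joint
  measurability is needed for exchanging expectation and time integral and for the measurability of
  the drift.\<close>

lemma X_joint_measurable: "(\<lambda>(x, s). X s x) \<in> borel_measurable (M \<Otimes>\<^sub>M lborel)"
proof (rule borel_measurable_LIMSEQ_real)
  let ?r = "\<lambda>n s. of_int \<lfloor>real (Suc n) * s\<rfloor> / real (Suc n)"
  show "(\<lambda>(x, s). X (?r n s) x) \<in> borel_measurable (M \<Otimes>\<^sub>M lborel)" for n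
  proof -
    have "(\<lambda>z. (\<lambda>i z. X (of_int i / real (Suc n)) (fst z)) \<lfloor>real (Suc n) * snd z\<rfloor> z) \<in> borel_measurable (M \<Otimes>\<^sub>M lborel)"
      by (rule measurable_compose_countable) measurable
    then show ?thesis by (simp add: case_prod_beta')
  qed
  fix z assume z: "z \<in> space (M \<Otimes>\<^sub>M (lborel :: real measure))"
  obtain x s where [simp]: "z = (x, s)" by (cases z)
  have "x \<in> space M" using z by (simp add: space_pair_measure)
  have "\<bar>?r n s - s\<bar> \<le> 1 / real (Suc n)" for n
  proof -
    have "\<bar>of_int \<lfloor>real (Suc n) * s\<rfloor> - real (Suc n) * s\<bar> \<le> 1" by linarith
    then have "\<bar>of_int \<lfloor>real (Suc n) * s\<rfloor> - real (Suc n) * s\<bar> / real (Suc n) \<le> 1 / real (Suc n)"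
      by (intro divide_right_mono) auto
    moreover have "?r n s - s = (of_int \<lfloor>real (Suc n) * s\<rfloor> - real (Suc n) * s) / real (Suc n)"
      by (simp add: diff_divide_distrib del: of_nat_Suc)
    ultimately show ?thesis by (simp only: abs_divide abs_of_nat)
  qed
  then have "(\<lambda>n. ?r n s - s) \<longlonglongrightarrow> 0"
    by (intro Lim_null_comparison[OF always_eventually LIMSEQ_Suc[OF lim_const_over_n[of 1]]])
      (simp del: of_nat_Suc)
  then have "(\<lambda>n. ?r n s) \<longlonglongrightarrow> s" by (rule LIM_zero_cancel)
  moreover have "isCont (\<lambda>t. X t x) s"
    using X_continuous[OF \<open>x \<in> space M\<close>] by (simp add: continuous_on_eq_continuous_at)
  ultimately show "(\<lambda>n. (\<lambda>(x, s). X (?r n s) x) z) \<longlonglongrightarrow> (case z of (x, s) \<Rightarrow> X s x)"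
    using isCont_tendsto_compose by simp
qed

lemma X_joint_measurable' [measurable (raw)]:
  assumes [measurable]: "f \<in> measurable N M" "g \<in> borel_measurable N"
  shows "(\<lambda>z. X (g z) (f z)) \<in> borel_measurable N"
  using measurable_compose[OF measurable_Pair X_joint_measurable, of f N g] by simp

definition drift :: "real \<Rightarrow> real \<Rightarrow> 'a \<Rightarrow> real" where
  "drift lam t x = lam * (LINT s:{..t}|lborel. exp (- lam * (t - s)) * X s x)"

lemma drift_measurable [measurable]: "drift lam t \<in> borel_measurable M"
  unfolding drift_def[abs_def] set_lebesgue_integral_def by measurable

text \<open>By Tonelli, the expectation of the integral of absolute values is finite, because first
  moments grow at most linearly. The kernel is written without \<open>t\<close>, so that a single
  null set serves all \<open>t \<le> T\<close>.\<close>

lemma AE_set_integrable_exp: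
  assumes "lam > 0"
  shows "AE x in M. set_integrable lborel {..T} (\<lambda>s. exp (lam * s) * X s x)"
proof -
  let ?f = "\<lambda>x s. ennreal (indicator {..T} s * (exp (lam * s) * \<bar>X s x\<bar>))"
  define K where "K = gaussian_abs_moment 1 * sqrt (\<Sum>k. (\<sigma> k)\<^sup>2)"
  have K: "K \<ge> 0" unfolding K_def using gaussian_abs_moment_pos[of 1]
    by (intro mult_nonneg_nonneg real_sqrt_ge_zero suminf_nonneg \<sigma>_summable) auto
  interpret pair_sigma_finite M lborel ..
  have "(\<integral>\<^sup>+x. (\<integral>\<^sup>+s. ?f x s \<partial>lborel) \<partial>M) = (\<integral>\<^sup>+s. (\<integral>\<^sup>+x. ?f x s \<partial>M) \<partial>lborel)"
    by (rule Fubini'[symmetric]) measurable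
  also have "\<dots> \<le> (\<integral>\<^sup>+s. ennreal (indicator {..T} s * (exp (lam * s) * (K * (1 + \<bar>s\<bar>)))) \<partial>lborel)"
  proof (rule nn_integral_mono_AE)
    \<comment> \<open>The moment bound excludes time \<open>0\<close>, which is
      Lebesgue-null.\<close>
    have "AE s in lborel. s \<noteq> (0::real)" by (rule AE_lborel_singleton)
    then show "AE s in lborel. (\<integral>\<^sup>+x. ?f x s \<partial>M) \<le> ennreal (indicator {..T} s * (exp (lam * s) * (K * (1 + \<bar>s\<bar>))))"
    proof eventually_elim
      case (elim s)
      have "(\<integral>\<^sup>+x. ?f x s \<partial>M) = ennreal (expectation (\<lambda>x. indicator {..T} s * (exp (lam * s) * \<bar>X s x\<bar>)))"
        using expectation_abs_le(1)[OF elim] by (intro nn_integral_eq_integral) auto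
      also have "\<dots> = ennreal (indicator {..T} s * (exp (lam * s) * expectation (\<lambda>x. \<bar>X s x\<bar>)))"
        by simp
      also have "\<dots> \<le> ennreal (indicator {..T} s * (exp (lam * s) * (K * (1 + \<bar>s\<bar>))))"
        using expectation_abs_le(2)[OF elim] unfolding K_def
        by (intro ennreal_leI mult_left_mono) auto
      finally show ?case .
    qed
  qed
  also have "\<dots> < \<infinity>" by (rule nn_integral_exp_times_linear_finite[OF assms K])
  finally have fin: "(\<integral>\<^sup>+x. (\<integral>\<^sup>+s. ?f x s \<partial>lborel) \<partial>M) \<noteq> \<infinity>" by simp
  have "AE x in M. (\<integral>\<^sup>+s. ?f x s \<partial>lborel) \<noteq> \<infinity>"
    by (rule nn_integral_PInf_AE[OF _ fin]) measurable
  then show ?thesis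
    using AE_space
  proof eventually_elim
    case (elim x)
    have [measurable]: "(\<lambda>s. X s x) \<in> borel_measurable borel"
      using X_continuous[OF elim(2)] by (rule borel_measurable_continuous_onI)
    show ?case
      unfolding set_integrable_def
    proof (rule integrableI_bounded)
      have "(\<integral>\<^sup>+s. ennreal (norm (indicator {..T} s *\<^sub>R (exp (lam * s) * X s x))) \<partial>lborel) = (\<integral>\<^sup>+s. ?f x s \<partial>lborel)"
        by (simp add: abs_mult)
      then show "(\<integral>\<^sup>+s. ennreal (norm (indicator {..T} s *\<^sub>R (exp (lam * s) * X s x))) \<partial>lborel) < \<infinity>"
        using elim(1) by (simp add: top.not_eq_extremum)
    qed measurable
  qed
qed

lemma AE_drift_Lipschitz:
  assumes "lam > 0"
  shows "AE x in M. \<exists>C\<ge>0. \<forall>s t. 0 \<le> s \<longrightarrow> s \<le> t \<longrightarrow> t \<le> T \<longrightarrow> \<bar>drift lam t x - drift lam s x\<bar> \<le> C * (t - s)"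
  using AE_set_integrable_exp[OF assms, of T] AE_space
proof eventually_elim
  case (elim x)
  have "continuous_on {0..T} (\<lambda>s. X s x)"
    using X_continuous[OF elim(2)] by (rule continuous_on_subset) simp
  then obtain C where C: "C \<ge> 0" "\<And>s t. \<lbrakk>0 \<le> s; s \<le> t; t \<le> T\<rbrakk> \<Longrightarrow>
      \<bar>(LINT r:{..t}|lborel. exp (- lam * (t - r)) * X r x) - (LINT r:{..s}|lborel. exp (- lam * (s - r)) * X r x)\<bar>
        \<le> C * (t - s)"
    using set_integrable_exp_integral_Lipschitz[OF assms elim(1)] by blast
  show ?case
  proof (intro exI[of _ "lam * C"] conjI allI impI)
    show "0 \<le> lam * C" using assms C by simp
    fix s t assume "0 \<le> s" "s \<le> t" "t \<le> T"
    then show "\<bar>drift lam t x - drift lam s x\<bar> \<le> lam * C * (t - s)"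
      unfolding drift_def right_diff_distrib[symmetric] abs_mult
      using C(2)[of s t] assms by (simp add: mult.assoc)
  qed
qed

text \<open>The order of the two times is reversed because the drift is subtracted: added to
  \<open>std_incr\<close>, this gives the increment of the Ornstein--Uhlenbeck process in the
  normalisation of the driving process.\<close>

definition std_drift_incr :: "real \<Rightarrow> real \<Rightarrow> nat \<Rightarrow> 'a \<Rightarrow> real" where
  "std_drift_incr lam h k x =
     (drift lam (real (k - 1) * h) x - drift lam (real k * h) x) / sqrt (mmfBM_var \<sigma> H h)"

lemma std_drift_incr_measurable [measurable]: "std_drift_incr lam h k \<in> borel_measurable M"
  unfolding std_drift_incr_def[abs_def] by measurable

text \<open>Almost every path has drift increments of size at most \<open>C * h\<close>, while
  component \<open>0\<close> alone makes the normalising deviation at least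
  \<open>\<sigma> 0 * h powr H 0\<close>. The ratio is of order \<open>h powr (1 - H 0)\<close>,
  uniformly in \<open>k\<close>, so the convergence even holds almost surely.\<close>

lemma std_drift_incr_mean_abs_powr:
  assumes "lam > 0" "p > 0" "T > 0"
  shows "tendsto_in_prob M (\<lambda>n x. (\<Sum>k=1..n. \<bar>std_drift_incr lam (T / real n) k x\<bar> powr p) / real n) (ereal 0)"
proof (rule tendsto_in_prob_if_AE)
  show "AE x in M. (\<lambda>n. (\<Sum>k=1..n. \<bar>std_drift_incr lam (T / real n) k x\<bar> powr p) / real n) \<longlonglongrightarrow> 0"
    using AE_drift_Lipschitz[OF \<open>lam > 0\<close>, of T]
  proof eventually_elim
    case (elim x)
    then obtain C where C: "C \<ge> 0"
      "\<And>s t. 0 \<le> s \<Longrightarrow> s \<le> t \<Longrightarrow> t \<le> T \<Longrightarrow> \<bar>drift lam t x - drift lam s x\<bar> \<le> C * (t - s)" by blast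
    define b where "b n = (C / \<sigma> 0 * (T / real n) powr (1 - H 0)) powr p" for n
    have le: "\<bar>std_drift_incr lam (T / real n) k x\<bar> powr p \<le> b n" if k: "k \<in> {1..n}" for n k
    proof -
      let ?h = "T / real n"
      have h: "?h > 0" using k \<open>T > 0\<close> by simp
      have "\<bar>drift lam (real k * ?h) x - drift lam (real (k - 1) * ?h) x\<bar> \<le> C * (real k * ?h - real (k - 1) * ?h)"
        using k \<open>T > 0\<close> by (intro C(2)) (auto simp: field_simps)
      also have "real k * ?h - real (k - 1) * ?h = ?h"
        using k by (simp add: of_nat_diff left_diff_distrib[symmetric] del: times_divide_eq_right)
      finally have 1: "\<bar>drift lam (real (k - 1) * ?h) x - drift lam (real k * ?h) x\<bar> \<le> C * ?h"
        by (simp only: abs_minus_commute)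
      have "(?h powr H 0)\<^sup>2 = \<bar>?h\<bar> powr (2 * H 0)"
        using h \<open>T > 0\<close> by (simp add: power2_eq_square flip: powr_add)
      then have "(\<sigma> 0 * ?h powr H 0)\<^sup>2 \<le> mmfBM_var \<sigma> H ?h"
        using term_le_var[of 0 ?h] by (simp only: power_mult_distrib)
      then have 2: "\<sigma> 0 * ?h powr H 0 \<le> sqrt (mmfBM_var \<sigma> H ?h)" by (rule real_le_rsqrt)
      have 3: "0 < \<sigma> 0 * ?h powr H 0" using k h \<open>T > 0\<close> \<sigma>_pos[of 0] by (intro mult_pos_pos) auto
      have "\<bar>std_drift_incr lam ?h k x\<bar> =
          \<bar>drift lam (real (k - 1) * ?h) x - drift lam (real k * ?h) x\<bar> / sqrt (mmfBM_var \<sigma> H ?h)"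
        unfolding std_drift_incr_def abs_divide using 2 3 by (simp only: abs_of_nonneg)
      also have "\<dots> \<le> C * ?h / (\<sigma> 0 * ?h powr H 0)"
        using 1 2 3 C(1) h by (intro frac_le) auto
      also have "\<dots> = C / \<sigma> 0 * ?h powr (1 - H 0)"
        using h by (simp only: powr_diff powr_one) simp
      finally show ?thesis unfolding b_def using \<open>p > 0\<close> by (intro powr_mono2) auto
    qed
    have sum_le: "(\<Sum>k=1..n. \<bar>std_drift_incr lam (T / real n) k x\<bar> powr p) / real n \<le> b n" for n
    proof (cases "n = 0")
      case False
      have "(\<Sum>k=1..n. \<bar>std_drift_incr lam (T / real n) k x\<bar> powr p) \<le> real n * b n"
        using sum_bounded_above[of "{1..n}", OF le] by simp
      then show ?thesis using False by (simp add: field_simps)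
    qed (simp add: b_def)
    have "(\<lambda>n. T / real n) \<longlonglongrightarrow> 0" by (rule lim_const_over_n)
    then have "(\<lambda>n. (T / real n) powr (1 - H 0)) \<longlonglongrightarrow> 0 powr (1 - H 0)"
      using \<open>T > 0\<close> H_less[of 0] by (intro tendsto_powr' tendsto_const) auto
    then have "(\<lambda>n. C / \<sigma> 0 * (T / real n) powr (1 - H 0)) \<longlonglongrightarrow> C / \<sigma> 0 * 0"
      by (intro tendsto_intros) simp
    then have "b \<longlonglongrightarrow> (C / \<sigma> 0 * 0) powr p"
      unfolding b_def using C(1) \<sigma>_pos[of 0] \<open>p > 0\<close> by (intro tendsto_powr' tendsto_const) auto
    then have b0: "b \<longlonglongrightarrow> 0" by simp
    show ?case
      by (rule tendsto_sandwich[OF _ _ tendsto_const b0]) (auto simp: sum_le[simplified] intro!: always_eventually divide_nonneg_nonneg sum_nonneg)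
  qed
qed measurable

lemma std_incr_plus_drift_mean_abs_powr:
  assumes "lam > 0" "p > 0" "T > 0"
  shows "tendsto_in_prob M (\<lambda>n x. (\<Sum>k=1..n.
      \<bar>std_incr (T / real n) k x + std_drift_incr lam (T / real n) k x\<bar> powr p) / real n)
    (ereal (gaussian_abs_moment p))"
  by (rule tendsto_in_prob_mean_abs_powr_perturb[OF \<open>p > 0\<close> gaussian_abs_moment_pos[OF \<open>p > 0\<close>] _ _
        std_incr_mean_abs_powr[OF \<open>p > 0\<close> \<open>T > 0\<close>] std_drift_incr_mean_abs_powr[OF assms]]) measurable

end

section \<open>The \<open>p\<close>-variations\<close>

context mmfBM_params
begin

definition pvar_scale :: "real \<Rightarrow> real \<Rightarrow> nat \<Rightarrow> real" where
  "pvar_scale p T n = real n * mmfBM_var \<sigma> H (T / real n) powr (p / 2)"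

text \<open>Keeping only component \<open>k\<close> bounds the scale below by a multiple of
  \<open>n powr (1 - p * H k)\<close>. An index below \<open>1 / p\<close> suffices; it need not be
  minimal.\<close>

lemma pvar_scale_at_top:
  assumes "p > 0" "T > 0" and "p * H k < 1"
  shows "filterlim (pvar_scale p T) at_top sequentially"
proof (rule filterlim_at_top_mono)
  let ?c = "((\<sigma> k)\<^sup>2) powr (p / 2) * T powr (p * H k)"
  have c: "?c > 0" using \<sigma>_pos[of k] \<open>T > 0\<close> by simp
  have "filterlim (\<lambda>n. exp ((1 - p * H k) * ln (real n))) at_top sequentially"
    using assms(3) by (intro filterlim_compose[OF exp_at_top] filterlim_tendsto_pos_mult_at_top[OF tendsto_const]
        filterlim_compose[OF ln_at_top] filterlim_real_sequentially) simp
  moreover have "\<forall>\<^sub>F n in sequentially. exp ((1 - p * H k) * ln (real n)) = real n powr (1 - p * H k)"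
    using eventually_ge_at_top[of 1] by eventually_elim (simp add: powr_def)
  ultimately have "filterlim (\<lambda>n. real n powr (1 - p * H k)) at_top sequentially"
    by (subst (asm) filterlim_cong[OF refl refl])
  then show "filterlim (\<lambda>n. ?c * real n powr (1 - p * H k)) at_top sequentially"
    using c by (intro filterlim_tendsto_pos_mult_at_top[OF tendsto_const])
  show "\<forall>\<^sub>F n in sequentially. ?c * real n powr (1 - p * H k) \<le> pvar_scale p T n"
    using eventually_ge_at_top[of 1]
  proof eventually_elim
    case (elim n)
    then have n: "real n > 0" by simp
    have "((\<sigma> k)\<^sup>2 * (T / real n) powr (2 * H k)) powr (p / 2) \<le> mmfBM_var \<sigma> H (T / real n) powr (p / 2)"
      using term_le_var[of k "T / real n"] \<open>T > 0\<close> \<open>p > 0\<close> n by (intro powr_mono2) auto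
    also have "((\<sigma> k)\<^sup>2 * (T / real n) powr (2 * H k)) powr (p / 2) =
        ((\<sigma> k)\<^sup>2) powr (p / 2) * (T powr (p * H k) / real n powr (p * H k))"
      using \<open>T > 0\<close> n by (simp add: powr_mult powr_powr powr_divide mult_ac)
    finally have "real n * (((\<sigma> k)\<^sup>2) powr (p / 2) * (T powr (p * H k) / real n powr (p * H k))) \<le> pvar_scale p T n"
      unfolding pvar_scale_def by (intro mult_left_mono) auto
    moreover have "real n * (((\<sigma> k)\<^sup>2) powr (p / 2) * (T powr (p * H k) / real n powr (p * H k))) =
        ?c * real n powr (1 - p * H k)"
      using n by (simp only: powr_diff powr_one) (simp add: mult_ac)
    ultimately show ?case by simp
  qed
qed

text \<open>Termwise, the quotient contains \<open>h powr (2 * (H k - H_inf))\<close>, which stays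
  \<open>1\<close> at minimal indices and vanishes in the limit at all others. For
  \<open>h \<le> 1\<close> it is at most \<open>1\<close>, so \<open>(\<sigma> k)\<^sup>2\<close>
  dominates and Tannery's theorem exchanges limit and sum.\<close>

lemma var_div_powr_tendsto:
  assumes Hinf: "\<And>k. H_inf \<le> H k" and fin: "finite {k. H k = H_inf}"
  shows "((\<lambda>h. mmfBM_var \<sigma> H h / h powr (2 * H_inf)) \<longlongrightarrow> (\<Sum>k | H k = H_inf. (\<sigma> k)\<^sup>2)) (at_right 0)"
proof -
  let ?f = "\<lambda>k h. (\<sigma> k)\<^sup>2 * h powr (2 * (H k - H_inf))"
  let ?g = "\<lambda>k. if k \<in> {k. H k = H_inf} then (\<sigma> k)\<^sup>2 else 0"
  have pos: "\<forall>\<^sub>F h in at_right 0. (0::real) < h \<and> h \<le> 1"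
    by (auto simp: eventually_at_right_field intro!: exI[of _ 1])
  have "((\<lambda>h. \<Sum>k. ?f k h) \<longlongrightarrow> (\<Sum>k. ?g k)) (at_right 0)"
  proof (rule tannerys_theorem[THEN conjunct2, THEN conjunct2])
    show "((\<lambda>h. ?f k h) \<longlongrightarrow> ?g k) (at_right 0)" for k
    proof (cases "H k = H_inf")
      case True
      have "\<forall>\<^sub>F h in at_right 0. ?f k h = (\<sigma> k)\<^sup>2"
        using pos by eventually_elim (simp add: True)
      then show ?thesis using True by (simp add: tendsto_eventually)
    next
      case False
      then have "2 * (H k - H_inf) > 0" using Hinf[of k] by simp
      then have "((\<lambda>h. ?f k h) \<longlongrightarrow> (\<sigma> k)\<^sup>2 * 0 powr (2 * (H k - H_inf))) (at_right 0)"
        using pos by (intro tendsto_mult tendsto_const tendsto_powr' tendsto_ident_at)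
          (auto elim: eventually_mono)
      then show ?thesis using False by simp
    qed
    show "\<forall>\<^sub>F (k, h) in at_top \<times>\<^sub>F at_right 0. norm (?f k h) \<le> (\<sigma> k)\<^sup>2"
    proof (rule eventually_mono[OF eventually_prodI[OF eventually_True pos]])
      fix z :: "nat \<times> real"
      assume z: "True \<and> 0 < snd z \<and> snd z \<le> 1"
      have "snd z powr (2 * (H (fst z) - H_inf)) \<le> 1"
        using z Hinf[of "fst z"] by (intro powr_le1) auto
      then show "case z of (k, h) \<Rightarrow> norm (?f k h) \<le> (\<sigma> k)\<^sup>2"
        by (cases z) (simp add: mult_left_le)
    qed
  qed (use \<sigma>_summable in auto)
  also have "(\<Sum>k. ?g k) = (\<Sum>k | H k = H_inf. (\<sigma> k)\<^sup>2)"
    using sums_If_finite_set[OF fin, of "\<lambda>k. (\<sigma> k)\<^sup>2"] by (rule sums_unique[symmetric])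
  finally show ?thesis
  proof (rule Lim_transform_eventually)
    show "\<forall>\<^sub>F h in at_right 0. (\<Sum>k. ?f k h) = mmfBM_var \<sigma> H h / h powr (2 * H_inf)"
      using pos
    proof eventually_elim
      case (elim h)
      have "?f k h = (\<sigma> k)\<^sup>2 * \<bar>h\<bar> powr (2 * H k) / h powr (2 * H_inf)" for k
        using elim by (simp add: right_diff_distrib powr_diff)
      then have "(\<Sum>k. ?f k h) = (\<Sum>k. (\<sigma> k)\<^sup>2 * \<bar>h\<bar> powr (2 * H k) / h powr (2 * H_inf))" by simp
      also have "\<dots> = mmfBM_var \<sigma> H h / h powr (2 * H_inf)"
        unfolding mmfBM_var_def by (rule suminf_divide[OF var_summable])
      finally show ?case .
    qed
  qed
qed

text \<open>Since \<open>T = n * h\<close>, the scale factors as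
  \<open>T * h powr (p * H_inf - 1)\<close> times the variance ratio to the power
  \<open>p / 2\<close>. The exponent of \<open>h\<close> separates the critical case from the
  vanishing one; at the critical value an empty sum gives \<open>0 powr (p / 2) = 0\<close>.\<close>

lemma pvar_scale_tendsto:
  assumes p: "p > 0" and T: "T > 0" and "p * H_inf \<ge> 1"
    and Hinf: "\<And>k. H_inf \<le> H k" and fin: "finite {k. H k = H_inf}"
  shows "pvar_scale p T \<longlonglongrightarrow>
    (if p * H_inf = 1 then T * (\<Sum>k | H k = H_inf. (\<sigma> k)\<^sup>2) powr (p / 2) else 0)"
proof -
  let ?S = "\<Sum>k | H k = H_inf. (\<sigma> k)\<^sup>2"
  define h where "h n = T / real n" for n
  have h0: "h \<longlonglongrightarrow> 0" unfolding h_def by (rule lim_const_over_n)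
  have hpos: "\<forall>\<^sub>F n in sequentially. h n > 0"
    using eventually_ge_at_top[of 1] by eventually_elim (simp add: h_def T)
  have hlim: "filterlim h (at_right 0) sequentially"
    using h0 hpos by (auto simp: filterlim_at elim: eventually_mono)
  have ratio: "(\<lambda>n. mmfBM_var \<sigma> H (h n) / h n powr (2 * H_inf)) \<longlonglongrightarrow> ?S"
    by (rule filterlim_compose[OF var_div_powr_tendsto[OF Hinf fin] hlim])
  have "\<forall>\<^sub>F n in sequentially. 0 \<le> mmfBM_var \<sigma> H (h n) / h n powr (2 * H_inf)"
    using hpos by eventually_elim (auto intro!: divide_nonneg_nonneg less_imp_le[OF var_pos])
  then have ratio': "(\<lambda>n. (mmfBM_var \<sigma> H (h n) / h n powr (2 * H_inf)) powr (p / 2)) \<longlonglongrightarrow> ?S powr (p / 2)"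
    using p ratio by (intro tendsto_powr' tendsto_const) auto
  have hp: "(\<lambda>n. h n powr (p * H_inf - 1)) \<longlonglongrightarrow> (if p * H_inf = 1 then 1 else 0)"
  proof (cases "p * H_inf = 1")
    case True
    have "\<forall>\<^sub>F n in sequentially. h n powr (p * H_inf - 1) = 1"
      using hpos by eventually_elim (simp add: True)
    then show ?thesis by (simp add: True tendsto_eventually)
  next
    case False
    with assms(3) have "p * H_inf - 1 > 0" by simp
    then have "(\<lambda>n. h n powr (p * H_inf - 1)) \<longlonglongrightarrow> 0 powr (p * H_inf - 1)"
      using h0 hpos by (intro tendsto_powr' tendsto_const) (auto elim: eventually_mono)
    then show ?thesis using False by simp
  qed
  have "(\<lambda>n. T * h n powr (p * H_inf - 1) * (mmfBM_var \<sigma> H (h n) / h n powr (2 * H_inf)) powr (p / 2))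
      \<longlonglongrightarrow> T * (if p * H_inf = 1 then 1 else 0) * ?S powr (p / 2)"
    by (intro tendsto_mult tendsto_const hp ratio')
  moreover have "\<forall>\<^sub>F n in sequentially.
      T * h n powr (p * H_inf - 1) * (mmfBM_var \<sigma> H (h n) / h n powr (2 * H_inf)) powr (p / 2) = pvar_scale p T n"
    using hpos
  proof eventually_elim
    case (elim n)
    then have n: "n \<noteq> 0" by (cases "n = 0") (auto simp: h_def)
    have V: "mmfBM_var \<sigma> H (h n) > 0" using elim by (intro var_pos) simp
    have "T = real n * h n" using n by (simp add: h_def)
    moreover have "(mmfBM_var \<sigma> H (h n) / h n powr (2 * H_inf)) powr (p / 2) =
        mmfBM_var \<sigma> H (h n) powr (p / 2) / h n powr (p * H_inf)"
      using V elim by (simp add: powr_divide powr_powr mult_ac)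
    moreover have "h n powr (p * H_inf - 1) = h n powr (p * H_inf) / h n"
      using elim by (simp add: powr_diff)
    ultimately show ?case
      using elim by (simp add: pvar_scale_def h_def[symmetric])
  qed
  ultimately have "pvar_scale p T \<longlonglongrightarrow> T * (if p * H_inf = 1 then 1 else 0) * ?S powr (p / 2)"
    by (rule Lim_transform_eventually)
  then show ?thesis by (auto split: if_splits)
qed

end

section \<open>From means of standardised increments to the variations\<close>

context mmfBM
begin

lemma p_variation_sum_eq:
  assumes "T > 0" and incr: "\<And>k. \<lbrakk>1 \<le> k; k \<le> n\<rbrakk> \<Longrightarrow>
    y k = (Z (real k * (T / real n)) x - Z (real (k - 1) * (T / real n)) x) / sqrt (mmfBM_var \<sigma> H (T / real n))"
  shows "p_variation_sum p T Z n x = pvar_scale p T n * ((\<Sum>k=1..n. \<bar>y k\<bar> powr p) / real n)"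
proof (cases "n = 0")
  case False
  let ?V = "mmfBM_var \<sigma> H (T / real n)"
  have V: "?V > 0" using False \<open>T > 0\<close> by (intro var_pos) simp
  have "\<bar>Z (real k / real n * T) x - Z (real (k - 1) / real n * T) x\<bar> powr p = ?V powr (p / 2) * \<bar>y k\<bar> powr p"
    if "k \<in> {1..n}" for k
  proof -
    have "Z (real k / real n * T) x - Z (real (k - 1) / real n * T) x = sqrt ?V * y k"
      using that V by (simp add: incr mult.commute)
    then show ?thesis
      using V by (simp add: abs_mult powr_mult powr_half_sqrt[symmetric] powr_powr)
  qed
  then have "p_variation_sum p T Z n x = ?V powr (p / 2) * (\<Sum>k=1..n. \<bar>y k\<bar> powr p)"
    unfolding p_variation_sum_def sum_distrib_left by (rule sum.cong[OF refl])
  then show ?thesis using False by (simp add: pvar_scale_def)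
qed (simp add: p_variation_sum_def)

text \<open>Stated for an arbitrary process \<open>Z\<close> so that it serves the driving process
  and the Ornstein--Uhlenbeck process alike: both are normalised by the variance of the former, and
  only the law of large numbers for the normalised increments has to be supplied.\<close>

lemma has_p_variation_if_mean_abs_powr:
  assumes p: "p > 0" and T: "T > 0" and Hinf: "\<And>k. H_inf \<le> H k" and fin: "finite {k. H k = H_inf}"
    and attained: "p * H_inf < 1 \<Longrightarrow> \<exists>k. p * H k < 1"
    and mean: "tendsto_in_prob M (\<lambda>n x. (\<Sum>k=1..n. \<bar>Y n k x\<bar> powr p) / real n) (ereal (gaussian_abs_moment p))"
    and incr: "\<And>n k x. \<lbrakk>1 \<le> k; k \<le> n\<rbrakk> \<Longrightarrow>
      Y n k x = (Z (real k * (T / real n)) x - Z (real (k - 1) * (T / real n)) x) / sqrt (mmfBM_var \<sigma> H (T / real n))"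
  shows "has_p_variation M p T Z (if p * H_inf < 1 then \<infinity>
    else if p * H_inf = 1 then ereal (T * (\<Sum>k | H k = H_inf. (\<sigma> k)\<^sup>2) powr (p / 2) * gaussian_abs_moment p)
    else 0)"
proof -
  have eq: "p_variation_sum p T Z = (\<lambda>n x. pvar_scale p T n * ((\<Sum>k=1..n. \<bar>Y n k x\<bar> powr p) / real n))"
    by (intro ext p_variation_sum_eq[OF T] incr)
  show ?thesis
  proof (cases "p * H_inf < 1")
    case True
    then obtain k where "p * H k < 1" using attained by blast
    then have "filterlim (pvar_scale p T) at_top sequentially"
      using p T by (rule pvar_scale_at_top[rotated 2])
    from tendsto_in_prob_mult_at_top[OF mean gaussian_abs_moment_pos[OF p] this] True
    show ?thesis by (simp add: has_p_variation_def eq)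
  next
    case False
    then have "1 \<le> p * H_inf" by simp
    from tendsto_in_prob_mult_const[OF mean pvar_scale_tendsto[OF p T this Hinf fin]] False
    show ?thesis by (auto simp: has_p_variation_def eq zero_ereal_def)
  qed
qed

end

theorem theorem5p1:
  fixes P :: "'a measure" and \<sigma> H :: "nat \<Rightarrow> real" and M U :: "real \<Rightarrow> 'a \<Rightarrow> real"
    and lam p T H_inf :: real and v :: ereal
  assumes "prob_space P"
    and "\<And>k. \<sigma> k > 0" and "summable (\<lambda>k. (\<sigma> k)\<^sup>2)"
    and "\<And>k. 0 < H k" and "\<And>k. H k < 1" and "inj H"
    and "(INF k. H k) > 0" and "(SUP k. H k) < 1"
    and "multi_mixed_fBM P \<sigma> H M"
    and "lam > 0" and "U = multi_mixed_fOU lam M"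
    and "p > 0" and "T > 0"
    and "H_inf = (INF k. H k)"
    and "v = (if p * H_inf < 1 then \<infinity>
              else if p * H_inf = 1 then
                ereal (T * (\<Sum>i\<in>{i. H i = H_inf}. (\<sigma> i)\<^sup>2) powr (p / 2) * gaussian_abs_moment p)
              else 0)"
  shows "has_p_variation P p T M v \<and> has_p_variation P p T U v"
proof -
  have bdd: "bdd_above (range H)" "bdd_below (range H)"
    using assms(4,5) by (auto intro!: bdd_aboveI2[of _ _ 1] bdd_belowI2[of _ 0] less_imp_le)
  interpret prob_space P by fact
  interpret mmfBM P \<sigma> H "SUP k. H k" M
    by unfold_locales (use assms bdd in \<open>auto intro: cSUP_upper\<close>)
  have Hinf: "H_inf \<le> H k" for k
    unfolding assms(14) using bdd by (intro cINF_lower) auto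
  \<comment> \<open>\<open>H\<close> is injective, so at most one index attains the infimum.\<close>
  have fin: "finite {k. H k = H_inf}"
    using finite_vimageI[OF _ \<open>inj H\<close>, of "{H_inf}"] by (simp add: vimage_def)
  \<comment> \<open>The infimum itself may not be attained, but it lies strictly below
    \<open>1 / p\<close>, so some index does as well.\<close>
  have attained: "\<exists>k. p * H k < 1" if "p * H_inf < 1"
  proof -
    have "(INF k. H k) < 1 / p" using that \<open>p > 0\<close> by (simp add: assms(14) field_simps)
    then obtain k where "H k < 1 / p" using cINF_less_iff[of UNIV H] bdd by auto
    then show ?thesis using \<open>p > 0\<close> by (auto simp: field_simps)
  qed
  note pvar = has_p_variation_if_mean_abs_powr[OF \<open>p > 0\<close> \<open>T > 0\<close> Hinf fin attained]
  have "has_p_variation P p T M v"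
    unfolding assms(15)
    by (rule pvar[OF _ std_incr_mean_abs_powr[OF \<open>p > 0\<close> \<open>T > 0\<close>]]) (simp_all add: std_incr_def)
  moreover have "has_p_variation P p T U v"
    unfolding assms(15)
    \<comment> \<open>The two summands have the common denominator \<open>sqrt (V h)\<close>;
      joining them gives exactly the normalised increment of \<open>U\<close>.\<close>
    by (rule pvar[OF _ std_incr_plus_drift_mean_abs_powr[OF \<open>lam > 0\<close> \<open>p > 0\<close> \<open>T > 0\<close>]])
      (simp_all add: std_incr_def std_drift_incr_def assms(11) multi_mixed_fOU_def drift_def
        flip: add_divide_distrib)
  ultimately show ?thesis ..
qed

end
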